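(* Let $X$ and $Y$ be Banach spaces. (i) If $A: D(A)\subseteq X \to Y$ is a Fredholm operator (in the sense defined in the context), then $$A = B - F,$$ where $B: D(B)\subseteq X\to Y$ is a linear closed operator with $D(B)=D(A)$, $R(B)=Y$, $N(B)=\{0\}$, and $F: X\to Y$ is a finite-rank operator. (ii) Conversely, if $A = B-F$, where $B: D(B)\subseteq X\to Y$ is a linear closed densely defined operator with $R(B)=Y$ and $N(B)=\{0\}$, and $F: X\to Y$ is a finite-rank operator, then $A$ is closed, $D(A)=D(B)$, $R(A)=\overline{R(A)}$, and $\dim N(A)=\dim N(A^\ast)<\infty$; so $A$ is a Fredholm operator.
   Context: Operators are linear and possibly unbounded. For a linear operator $A$ from $X$ to $Y$ with domain $D(A)\subseteq X$, $R(A)=\{Au : u\in D(A)\}$ denotes its range and $N(A)=\{u\in D(A): Au=0\}$ its null space. For densely defined $A$, $A^\ast: D(A^\ast)\subseteq Y^\ast\to X^\ast$ denotes the Banach space adjoint, where $X^\ast, Y^\ast$ are the dual spaces of bounded linear functionals. Definition (Fredholm operator). A linear closed densely defined operator $A: D(A)\subseteq X\to Y$ between Banach spaces is called a Fredholm operator if and only if $R(A)=\overline{R(A)}$ (the range is closed in $Y$) and $\dim N(A)=\dim N(A^\ast)<\infty$. (Thus, with this terminology, a Fredholm operator has index zero.) Definition (finite-rank operator). A bounded linear operator $F: X\to Y$, defined on all of $X$, is called a finite-rank operator if $\dim R(F)<\infty$. The operator $B-F$ is understood with its natural domain, i.e. $(B-F)u=Bu-Fu$ for $u\in D(B)$. 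*)

theory Defs
  imports "HOL-Analysis.Analysis"
begin

(* The scalar field ranges over 'k :: {real_normed_field, euclidean_space}.  The reals and the
   complex numbers are instances, and up to isometric isomorphism the only ones, so real and
   complex Banach spaces are treated simultaneously.  The class banach provides the norm and
   completeness; s is the multiplication by scalars, required to extend the built-in
   multiplication by reals. *)

locale banach_space_over = vector_space s
  for s :: "'k::{real_normed_field, euclidean_space} \<Rightarrow> 'a::banach \<Rightarrow> 'a" +
  assumes norm_scale: "norm (s c x) = norm c * norm x"
    and scale_of_real: "s (of_real r) x = r *\<^sub>R x"

lemma banach_space_over_real:
  "banach_space_over (scaleR :: real \<Rightarrow> 'a::banach \<Rightarrow> 'a)"
  by unfold_locales (simp_all add: algebra_simps)

lemma banach_space_over_scalars:
  "banach_space_over ((*) :: 'k::{real_normed_field, euclidean_space} \<Rightarrow> 'k \<Rightarrow> 'k)"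
  by unfold_locales (simp_all add: algebra_simps norm_mult scaleR_conv_of_real)

(* vector_space.dim returns 0 on infinite-dimensional sets, so finiteness is stated separately. *)

definition finite_dim :: "('k::field \<Rightarrow> 'a::ab_group_add \<Rightarrow> 'a) \<Rightarrow> 'a set \<Rightarrow> bool" where
  "finite_dim s S \<longleftrightarrow> (\<exists>W. finite W \<and> S \<subseteq> module.span s W)"

(* A possibly unbounded operator is a partial function A :: 'x \<rightharpoonup> 'y, with D(A) = dom A and
   R(A) = ran A; equality of partial functions is equality of operators, domains included. *)

definition linear_operator ::
  "('k::field \<Rightarrow> 'x::ab_group_add \<Rightarrow> 'x) \<Rightarrow> ('k \<Rightarrow> 'y::ab_group_add \<Rightarrow> 'y) \<Rightarrow> ('x \<rightharpoonup> 'y) \<Rightarrow> bool"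
  where
  "linear_operator sX sY A \<longleftrightarrow>
     module.subspace sX (dom A) \<and>
     (\<forall>u\<in>dom A. \<forall>v\<in>dom A. the (A (u + v)) = the (A u) + the (A v)) \<and>
     (\<forall>c. \<forall>u\<in>dom A. the (A (sX c u)) = sY c (the (A u)))"

definition closed_operator :: "('x::topological_space \<rightharpoonup> 'y::topological_space) \<Rightarrow> bool" where
  "closed_operator A \<longleftrightarrow> closed (Map.graph A)"

definition densely_defined :: "('x::topological_space \<rightharpoonup> 'y) \<Rightarrow> bool" where
  "densely_defined A \<longleftrightarrow> closure (dom A) = UNIV"

definition null_space :: "('x \<rightharpoonup> 'y::zero) \<Rightarrow> 'x set" where
  "null_space A = {u. A u = Some 0}"

definition op_diff :: "('x \<rightharpoonup> 'y::minus) \<Rightarrow> ('x \<Rightarrow> 'y) \<Rightarrow> ('x \<rightharpoonup> 'y)" where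
  "op_diff B F = (\<lambda>u. map_option (\<lambda>v. v - F u) (B u))"

(* bounded_linear only gives linearity over the reals. *)

definition bounded_operator ::
  "('k::field \<Rightarrow> 'x::real_normed_vector \<Rightarrow> 'x) \<Rightarrow> ('k \<Rightarrow> 'y::real_normed_vector \<Rightarrow> 'y) \<Rightarrow>
   ('x \<Rightarrow> 'y) \<Rightarrow> bool" where
  "bounded_operator sX sY F \<longleftrightarrow> Vector_Spaces.linear sX sY F \<and> bounded_linear F"

definition finite_rank ::
  "('k::field \<Rightarrow> 'x::real_normed_vector \<Rightarrow> 'x) \<Rightarrow> ('k \<Rightarrow> 'y::real_normed_vector \<Rightarrow> 'y) \<Rightarrow>
   ('x \<Rightarrow> 'y) \<Rightarrow> bool" where
  "finite_rank sX sY F \<longleftrightarrow> bounded_operator sX sY F \<and> finite_dim sY (range F)"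

(* The dual space is the set of 'k-linear functionals inside the type of real-linear bounded
   maps into 'k, with 'k acting on the values. *)

definition dual_space ::
  "('k::real_normed_field \<Rightarrow> 'x::real_normed_vector \<Rightarrow> 'x) \<Rightarrow> ('x \<Rightarrow>\<^sub>L 'k) set" where
  "dual_space s = {f. bounded_operator s (*) (blinfun_apply f)}"

definition dual_scale ::
  "'k::real_normed_field \<Rightarrow> ('x::real_normed_vector \<Rightarrow>\<^sub>L 'k) \<Rightarrow> ('x \<Rightarrow>\<^sub>L 'k)" where
  "dual_scale c f = blinfun_mult_right c o\<^sub>L f"

lemma dual_scale_apply [simp]: "blinfun_apply (dual_scale c f) x = c * blinfun_apply f x"
  by (simp add: dual_scale_def)

lemma vector_space_dual_scale: "vector_space dual_scale"
  by unfold_locales (auto intro!: blinfun_eqI simp: blinfun.add_left algebra_simps)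

lemma subspace_dual_space:
  assumes "vector_space s"
  shows "module.subspace dual_scale (dual_space s)"
proof -
  interpret D: vector_space dual_scale by (rule vector_space_dual_scale)
  interpret S: vector_space s by (rule assms)
  have "vector_space ((*) :: 'a \<Rightarrow> 'a \<Rightarrow> 'a)"
    by unfold_locales (simp_all add: algebra_simps)
  then show ?thesis
    using assms
    by (auto simp: D.subspace_def dual_space_def bounded_operator_def Vector_Spaces.linear_iff
        blinfun.add_left blinfun.bounded_linear_right algebra_simps)
qed

(* The functional f below is unique when A is densely defined. *)

definition adjoint_op ::
  "('k::real_normed_field \<Rightarrow> 'x::real_normed_vector \<Rightarrow> 'x) \<Rightarrow>
   ('k \<Rightarrow> 'y::real_normed_vector \<Rightarrow> 'y) \<Rightarrow> ('x \<rightharpoonup> 'y) \<Rightarrow> (('y \<Rightarrow>\<^sub>L 'k) \<rightharpoonup> ('x \<Rightarrow>\<^sub>L 'k))" where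
  "adjoint_op sX sY A = (\<lambda>g.
     if g \<in> dual_space sY \<and>
        (\<exists>f\<in>dual_space sX. \<forall>u\<in>dom A. blinfun_apply f u = blinfun_apply g (the (A u)))
     then Some (THE f. f \<in> dual_space sX \<and>
        (\<forall>u\<in>dom A. blinfun_apply f u = blinfun_apply g (the (A u))))
     else None)"

definition equal_finite_nullity ::
  "('k::real_normed_field \<Rightarrow> 'x::real_normed_vector \<Rightarrow> 'x) \<Rightarrow>
   ('k \<Rightarrow> 'y::real_normed_vector \<Rightarrow> 'y) \<Rightarrow> ('x \<rightharpoonup> 'y) \<Rightarrow> bool" where
  "equal_finite_nullity sX sY A \<longleftrightarrow>
     finite_dim sX (null_space A) \<and>
     finite_dim dual_scale (null_space (adjoint_op sX sY A)) \<and>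
     vector_space.dim sX (null_space A) =
       vector_space.dim dual_scale (null_space (adjoint_op sX sY A))"

definition fredholm_operator ::
  "('k::real_normed_field \<Rightarrow> 'x::real_normed_vector \<Rightarrow> 'x) \<Rightarrow>
   ('k \<Rightarrow> 'y::real_normed_vector \<Rightarrow> 'y) \<Rightarrow> ('x \<rightharpoonup> 'y) \<Rightarrow> bool" where
  "fredholm_operator sX sY A \<longleftrightarrow>
     linear_operator sX sY A \<and> closed_operator A \<and> densely_defined A \<and>
     ran A = closure (ran A) \<and> equal_finite_nullity sX sY A"

end

theory Submission imports Defs
begin

text \<open>
  The null space of the adjoint of A is the annihilator of the range of A.  By the Hahn-Banach
  theorem, a closed subspace M has a finite-dimensional annihilator exactly if it has a finite
  complement V, and then V has a dual system of bounded functionals that vanish on M.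

  If A is Fredholm, take a basis W of its null space with dual functionals h, and a complement
  basis V of its range, of the same cardinality.  With a bijection from W to V written as p, the
  operator F(u) = sum of h(w)(u) p(w) over w in W maps the null space isomorphically onto the
  complement, and B = A + F is bijective.

  Conversely, T, the inverse of B, is bounded by the closed graph theorem, and B - F = (I - F T) B.
  So everything reduces to the operator L = I - F T with F T bounded of finite rank.  Its range is
  closed because it is the sum of the closed kernel of F T and a finite-dimensional space.  Its
  kernel and a complement of its range lie in the finite-dimensional range of F T, where they have
  equal dimensions by rank-nullity.
\<close>

section \<open>The Hahn-Banach theorem over the reals\<close>

definition sublinear :: "('a::real_vector \<Rightarrow> real) \<Rightarrow> bool" where
  "sublinear p \<longleftrightarrow> (\<forall>x y. p (x + y) \<le> p x + p y) \<and> (\<forall>t x. 0 \<le> t \<longrightarrow> p (t *\<^sub>R x) = t * p x)"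

lemma sublinear_zero: "sublinear p \<Longrightarrow> p 0 = 0"
  unfolding sublinear_def by (metis mult_zero_left order_refl scale_zero_left)

lemma sublinear_minus: "sublinear p \<Longrightarrow> 0 \<le> p x + p (- x)"
  using sublinear_zero[of p] unfolding sublinear_def by (metis add.right_inverse)

text \<open>Applying the inequality with \<open>inverse t\<close> to \<open>t *\<^sub>R x\<close>
  gives the reverse inequality, so one direction and positive factors are enough.\<close>

lemma sublinearI:
  assumes "\<And>x y. p (x + y) \<le> p x + p y" "p 0 = 0"
    and "\<And>t x. 0 < t \<Longrightarrow> p (t *\<^sub>R x) \<le> t * p x"
  shows "sublinear p"
proof -
  have "p (t *\<^sub>R x) = t * p x" if "0 < t" for t x
  proof (rule antisym)
    have "p (inverse t *\<^sub>R t *\<^sub>R x) \<le> inverse t * p (t *\<^sub>R x)"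
      by (rule assms(3)) (use that in simp)
    then show "t * p x \<le> p (t *\<^sub>R x)"
      using that by (simp add: field_simps)
  qed (rule assms(3)[OF that])
  then show ?thesis
    unfolding sublinear_def using assms by (metis less_eq_real_def mult_zero_left scale_zero_left)
qed

text \<open>This is a sublinear functional below p whose value at -x is at most
  -p(x).  A minimal sublinear functional coincides with all its modifications of this
  kind, so it is odd and hence linear.\<close>

definition lower_at :: "('a::real_vector \<Rightarrow> real) \<Rightarrow> 'a \<Rightarrow> 'a \<Rightarrow> real" where
  "lower_at p x y = (INF t\<in>{0..}. p (y + t *\<^sub>R x) - t * p x)"

text \<open>Writing \<open>t *\<^sub>R x\<close> as \<open>(y + t *\<^sub>R x) + (- y)\<close>,
  subadditivity yields the lower bound \<open>- p (- y)\<close> for all \<open>t\<close>, so the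
  infimum in \<open>lower_at\<close> is a genuine one.\<close>

lemma lower_at_bdd:
  assumes "sublinear p"
  shows "bdd_below ((\<lambda>t. p (y + t *\<^sub>R x) - t * p x) ` {0..})"
proof (rule bdd_belowI2)
  fix t :: real assume "t \<in> {0..}"
  then have "t * p x = p (t *\<^sub>R x)"
    using assms unfolding sublinear_def by simp
  also have "t *\<^sub>R x = (y + t *\<^sub>R x) + (- y)"
    by simp
  also have "p \<dots> \<le> p (y + t *\<^sub>R x) + p (- y)"
    using assms unfolding sublinear_def by blast
  finally show "- p (- y) \<le> p (y + t *\<^sub>R x) - t * p x"
    by simp
qed

lemma lower_at_le:
  assumes "sublinear p" "0 \<le> t"
  shows "lower_at p x y \<le> p (y + t *\<^sub>R x) - t * p x"
  unfolding lower_at_def by (rule cINF_lower[OF lower_at_bdd[OF assms(1)]]) (use assms in simp)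

lemma lower_at_greatest:
  assumes "\<And>t. 0 \<le> t \<Longrightarrow> c \<le> p (y + t *\<^sub>R x) - t * p x"
  shows "c \<le> lower_at p x y"
  unfolding lower_at_def by (rule cINF_greatest) (use assms in auto)

lemma sublinear_lower_at:
  assumes p: "sublinear p"
  shows "sublinear (lower_at p x)"
proof (rule sublinearI)
  fix y z
  \<comment> \<open>Parameters \<open>s\<close> for \<open>y\<close> and \<open>t\<close> for
    \<open>z\<close> add up to the admissible parameter \<open>s + t\<close> for
    \<open>y + z\<close>; the two infima are then taken one after the other.\<close>
  have "lower_at p x (y + z) - (p (y + s *\<^sub>R x) - s * p x) \<le> p (z + t *\<^sub>R x) - t * p x"
    if "0 \<le> s" "0 \<le> t" for s t
  proof -
    have "lower_at p x (y + z) \<le> p ((y + z) + (s + t) *\<^sub>R x) - (s + t) * p x"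
      by (rule lower_at_le) (use p that in auto)
    also have "(y + z) + (s + t) *\<^sub>R x = (y + s *\<^sub>R x) + (z + t *\<^sub>R x)"
      by (simp add: algebra_simps)
    also have "p \<dots> \<le> p (y + s *\<^sub>R x) + p (z + t *\<^sub>R x)"
      using p unfolding sublinear_def by blast
    finally show ?thesis
      by (simp add: algebra_simps)
  qed
  then have "lower_at p x (y + z) - (p (y + s *\<^sub>R x) - s * p x) \<le> lower_at p x z" if "0 \<le> s" for s
    using that by (intro lower_at_greatest) auto
  then have "lower_at p x (y + z) - lower_at p x z \<le> lower_at p x y"
    by (intro lower_at_greatest) (smt (verit))
  then show "lower_at p x (y + z) \<le> lower_at p x y + lower_at p x z"
    by simp
next
  have "0 \<le> p (0 + t *\<^sub>R x) - t * p x" if "0 \<le> t" for t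
    using p that unfolding sublinear_def by simp
  then have "0 \<le> lower_at p x 0"
    by (rule lower_at_greatest)
  then show "lower_at p x 0 = 0"
    using lower_at_le[OF p, of 0 x 0] sublinear_zero[OF p] by simp
next
  fix t :: real and y
  assume t: "0 < t"
  have "lower_at p x (t *\<^sub>R y) / t \<le> p (y + s *\<^sub>R x) - s * p x" if "0 \<le> s" for s
  proof -
    have "lower_at p x (t *\<^sub>R y) \<le> p (t *\<^sub>R y + (t * s) *\<^sub>R x) - (t * s) * p x"
      by (rule lower_at_le) (use p t that in auto)
    also have "t *\<^sub>R y + (t * s) *\<^sub>R x = t *\<^sub>R (y + s *\<^sub>R x)"
      by (simp add: algebra_simps)
    also have "p \<dots> = t * p (y + s *\<^sub>R x)"
      using p t unfolding sublinear_def by simp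
    finally show ?thesis
      using t by (simp add: field_simps)
  qed
  then have "lower_at p x (t *\<^sub>R y) / t \<le> lower_at p x y"
    by (rule lower_at_greatest)
  then show "lower_at p x (t *\<^sub>R y) \<le> t * lower_at p x y"
    using t by (simp add: field_simps)
qed

lemma lower_at_le_self: "sublinear p \<Longrightarrow> lower_at p x y \<le> p y"
  using lower_at_le[of p 0 x y] by simp

lemma lower_at_minus: "sublinear p \<Longrightarrow> lower_at p x (- x) \<le> - p x"
  using lower_at_le[of p 1 x "- x"] sublinear_zero[of p] by simp

text \<open>Infima of sublinear functionals need not be subadditive. In a chain, any two members
  \<open>q\<close> and \<open>r\<close> lie above a common member \<open>u\<close>, whose
  subadditivity bounds the infimum at \<open>x + y\<close> by \<open>q x + r y\<close>.\<close>

lemma sublinear_INF_chain: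
  assumes C: "C \<noteq> {}" "\<And>q. q \<in> C \<Longrightarrow> sublinear q"
    and chain: "\<And>q r. q \<in> C \<Longrightarrow> r \<in> C \<Longrightarrow> q \<le> r \<or> r \<le> q"
    and bdd: "\<And>x. bdd_below ((\<lambda>q. q x) ` C)"
  shows "sublinear (\<lambda>x. INF q\<in>C. q x)"
proof (rule sublinearI)
  note lower = cINF_lower[OF bdd]
  fix x y
  have step: "(INF q\<in>C. q (x + y)) \<le> q x + r y" if "q \<in> C" "r \<in> C" for q r
  proof -
    obtain u where u: "u \<in> C" "u \<le> q" "u \<le> r"
      using chain \<open>q \<in> C\<close> \<open>r \<in> C\<close> by blast
    have "(INF q\<in>C. q (x + y)) \<le> u (x + y)"
      by (rule lower[OF u(1)])
    also have "\<dots> \<le> u x + u y"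
      using C(2)[OF u(1)] unfolding sublinear_def by blast
    also have "\<dots> \<le> q x + r y"
      using u(2,3) by (intro add_mono) (auto simp: le_fun_def)
    finally show ?thesis .
  qed
  have "(INF q\<in>C. q (x + y)) - q x \<le> (INF r\<in>C. r y)" if "q \<in> C" for q
  proof (rule cINF_greatest[OF C(1)])
    fix r assume "r \<in> C"
    from step[OF that this] show "(INF q\<in>C. q (x + y)) - q x \<le> r y"
      by linarith
  qed
  then have "(INF q\<in>C. q (x + y)) - (INF r\<in>C. r y) \<le> (INF q\<in>C. q x)"
    using C(1) by (intro cINF_greatest) (auto simp: algebra_simps)
  then show "(INF q\<in>C. q (x + y)) \<le> (INF q\<in>C. q x) + (INF q\<in>C. q y)"
    by simp
next
  show "(INF q\<in>C. q 0) = 0"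
  proof -
    have "(\<lambda>q. q 0) ` C = (\<lambda>q. 0) ` C"
      using C(2) sublinear_zero by (intro image_cong) auto
    then show ?thesis
      using C(1) by simp
  qed
next
  fix t :: real and x
  assume t: "0 < t"
  have "(INF q\<in>C. q (t *\<^sub>R x)) / t \<le> q x" if "q \<in> C" for q
    using cINF_lower[OF bdd that, of "t *\<^sub>R x"] C(2)[OF that] t
    unfolding sublinear_def by (simp add: field_simps)
  then have "(INF q\<in>C. q (t *\<^sub>R x)) / t \<le> (INF q\<in>C. q x)"
    using C(1) by (intro cINF_greatest) auto
  then show "(INF q\<in>C. q (t *\<^sub>R x)) \<le> t * (INF q\<in>C. q x)"
    using t by (simp add: field_simps)
qed

text \<open>Zorn's lemma for the reversed order: the pointwise infimum is a lower bound of a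
  nonempty chain. It is finite because \<open>0 \<le> q x + q (- x)\<close> and
  \<open>q \<le> p\<close> force \<open>- p (- x) \<le> q x\<close>.\<close>

lemma minimal_sublinear_below:
  assumes p: "sublinear p"
  obtains q where "sublinear q" "q \<le> p" "\<And>r. sublinear r \<Longrightarrow> r \<le> q \<Longrightarrow> r = q"
proof -
  define A where "A = {q. sublinear q \<and> q \<le> p}"
  have "\<exists>m\<in>A. \<forall>a\<in>A. m \<ge> a \<longrightarrow> a = m"
  proof (rule predicate_Zorn)
    show "partial_order_on A (relation_of (\<ge>) A)"
      by (rule partial_order_on_relation_ofI) auto
    fix C assume C: "C \<in> Chains (relation_of (\<ge>) A)"
    show "\<exists>u\<in>A. \<forall>a\<in>C. a \<ge> u"
    proof (cases "C = {}")
      case True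
      then show ?thesis
        using p by (auto simp: A_def)
    next
      case False
      have CA: "C \<subseteq> A" and chain: "\<And>q r. q \<in> C \<Longrightarrow> r \<in> C \<Longrightarrow> q \<le> r \<or> r \<le> q"
        using C unfolding Chains_def relation_of_def by blast+
      have bdd: "bdd_below ((\<lambda>q. q x) ` C)" for x
      proof (rule bdd_belowI2)
        fix q assume "q \<in> C"
        then have "sublinear q" "q (- x) \<le> p (- x)"
          using CA by (auto simp: A_def le_fun_def)
        then show "- p (- x) \<le> q x"
          using sublinear_minus[of q x] by linarith
      qed
      let ?u = "\<lambda>x. INF q\<in>C. q x"
      have le: "?u \<le> q" if "q \<in> C" for q
        using cINF_lower[OF bdd that] by (simp add: le_fun_def)
      have "sublinear ?u"
        by (rule sublinear_INF_chain[OF False _ chain bdd]) (use CA in \<open>auto simp: A_def\<close>)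
      moreover have "?u \<le> p"
        using False le CA unfolding A_def by (metis (no_types, lifting) equals0I mem_Collect_eq order_trans subsetD)
      ultimately show ?thesis
        using le by (auto simp: A_def)
    qed
  qed
  then show ?thesis
    using that by (auto simp: A_def)
qed

text \<open>The minimal functional is taken below \<open>lower_at p x0\<close> instead of
  \<open>p\<close>. This forces \<open>q (- x0) \<le> - p x0\<close>, which oddness of
  \<open>q\<close> turns into equality at \<open>x0\<close>.\<close>

theorem Hahn_Banach_sublinear:
  fixes p :: "'a::real_vector \<Rightarrow> real"
  assumes p: "sublinear p"
  obtains f where "linear f" "\<And>x. f x \<le> p x" "f x0 = p x0"
proof -
  obtain q where q: "sublinear q" "q \<le> lower_at p x0"
    and min: "\<And>r. sublinear r \<Longrightarrow> r \<le> q \<Longrightarrow> r = q"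
    using minimal_sublinear_below[OF sublinear_lower_at[OF p, of x0]] by blast
  have minus: "q (- x) = - q x" for x
  proof -
    \<comment> \<open>\<open>lower_at q x\<close> is sublinear and below \<open>q\<close>, so
      minimality makes them equal; the value at \<open>- x\<close> then gives oddness.\<close>
    have "lower_at q x = q"
      by (rule min) (use q in \<open>auto simp: sublinear_lower_at lower_at_le_self le_fun_def\<close>)
    then show ?thesis
      using lower_at_minus[OF q(1), of x] sublinear_minus[OF q(1), of x] by simp
  qed
  have add: "q (x + y) = q x + q y" for x y
  proof (rule antisym)
    have "q (- x + - y) \<le> q (- x) + q (- y)"
      using q(1) unfolding sublinear_def by blast
    then show "q x + q y \<le> q (x + y)"
      using minus[of "x + y"] minus[of x] minus[of y] by simp
  qed (use q(1) in \<open>simp add: sublinear_def\<close>)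
  have scale: "q (t *\<^sub>R x) = t *\<^sub>R q x" for t x
  proof (cases "0 \<le> t")
    case True
    then show ?thesis
      using q(1) by (simp add: sublinear_def)
  next
    case False
    then have "q ((- t) *\<^sub>R x) = (- t) * q x"
      using q(1) unfolding sublinear_def by (metis linear neg_0_le_iff_le)
    then show ?thesis
      using minus[of "t *\<^sub>R x"] by simp
  qed
  have le: "q x \<le> p x" for x
    using q(2) lower_at_le_self[OF p, of x0 x] by (simp add: le_fun_def) (meson order_trans)
  have "q (- x0) \<le> - p x0"
    using q(2) lower_at_minus[OF p, of x0] by (simp add: le_fun_def) (meson order_trans)
  then have "q x0 = p x0"
    using minus[of x0] le[of x0] by simp
  moreover have "linear q"
    by (rule linearI) (auto simp: add scale)
  ultimately show ?thesis
    using that le by blast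
qed

section \<open>Separation of a point from a closed real subspace\<close>

text \<open>The distance to \<open>M\<close> is the quotient seminorm modulo \<open>M\<close>; a
  linear functional below it has to vanish on \<open>M\<close>.\<close>

lemma sublinear_infdist:
  fixes M :: "'a::real_normed_vector set"
  assumes M: "real_vector.subspace M"
  shows "sublinear (\<lambda>x. infdist x M)"
proof (rule sublinearI)
  have ne: "M \<noteq> {}"
    using M real_vector.subspace_0 by blast
  fix x y
  have "infdist (x + y) M \<le> dist x a + dist y b" if "a \<in> M" "b \<in> M" for a b
    using infdist_le[OF real_vector.subspace_add[OF M that], of "x + y"]
      norm_triangle_ineq[of "x - a" "y - b"] by (simp add: dist_norm algebra_simps)
  then have "infdist (x + y) M - dist x a \<le> infdist y M" if "a \<in> M" for a
    using ne that unfolding infdist_notempty[OF ne, of y]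
    by (intro cINF_greatest) (auto simp: algebra_simps)
  then have "infdist (x + y) M - infdist y M \<le> infdist x M"
    using ne unfolding infdist_notempty[OF ne, of x]
    by (intro cINF_greatest) (auto simp: algebra_simps)
  then show "infdist (x + y) M \<le> infdist x M + infdist y M"
    by simp
next
  show "infdist 0 M = 0"
    by (rule infdist_zero) (rule real_vector.subspace_0[OF M])
next
  have ne: "M \<noteq> {}"
    using M real_vector.subspace_0 by blast
  fix t :: real and x assume t: "0 < t"
  have "infdist (t *\<^sub>R x) M / t \<le> dist x a" if "a \<in> M" for a
  proof -
    have "dist (t *\<^sub>R x) (t *\<^sub>R a) = t * dist x a"
      using t by (simp add: dist_norm flip: scaleR_diff_right)
    then show ?thesis
      using infdist_le[OF real_vector.subspace_scale[OF M that], of "t *\<^sub>R x" t] t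
      by (simp add: field_simps)
  qed
  then have "infdist (t *\<^sub>R x) M / t \<le> infdist x M"
    unfolding infdist_notempty[OF ne, of x] using ne by (intro cINF_greatest) auto
  then show "infdist (t *\<^sub>R x) M \<le> t * infdist x M"
    using t by (simp add: field_simps)
qed

text \<open>Domination by the distance does everything: both signs together give zero on
  \<open>M\<close>, \<open>0 \<in> M\<close> gives the bound by the norm, and the value at
  \<open>x0\<close> is the distance, positive because \<open>M\<close> is closed.\<close>

lemma Hahn_Banach_separation_real:
  fixes M :: "'a::real_normed_vector set"
  assumes M: "real_vector.subspace M" "closed M" and x0: "x0 \<notin> M"
  obtains f where "bounded_linear f" "\<And>x. x \<in> M \<Longrightarrow> f x = (0::real)" "f x0 \<noteq> 0"
proof -
  have 0: "0 \<in> M"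
    by (rule real_vector.subspace_0[OF M(1)])
  obtain f where f: "linear f" "\<And>x. f x \<le> infdist x M" "f x0 = infdist x0 M"
    using Hahn_Banach_sublinear[OF sublinear_infdist[OF M(1)]] by blast
  have "\<bar>f x\<bar> \<le> norm x" for x
    using f(2)[of x] f(2)[of "- x"] infdist_le[OF 0, of x] infdist_le[OF 0, of "- x"]
    by (simp add: linear_neg[OF f(1)])
  then have "bounded_linear f"
    using f(1) by (intro bounded_linear_intro[where K = 1])
      (auto simp: linear_add linear_scale)
  moreover have "f x = 0" if "x \<in> M" for x
    using f(2)[of x] f(2)[of "- x"] that real_vector.subspace_neg[OF M(1) that]
    by (simp add: linear_neg[OF f(1)])
  moreover have "f x0 \<noteq> 0"
    using in_closed_iff_infdist_zero[OF M(2), of x0] 0 x0 f(3) by auto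
  ultimately show ?thesis
    using that by blast
qed

section \<open>The closed graph theorem\<close>

text \<open>Baire's theorem provides a ball in the closure of some sublevel set of
  \<open>norm (S y)\<close>. Successive approximation by a geometric series removes the closure, and
  the closed graph identifies the limit.\<close>

theorem closed_graph_theorem:
  fixes S :: "'a::banach \<Rightarrow> 'b::banach"
  assumes lin: "linear S"
    and graph: "\<And>f y x. f \<longlonglongrightarrow> y \<Longrightarrow> (\<lambda>n. S (f n)) \<longlonglongrightarrow> x \<Longrightarrow> S y = x"
  shows "bounded_linear S"
proof -
  define C where "C n = closure {y. norm (S y) \<le> real n}" for n
  have "\<exists>n. interior (C n) \<noteq> {}"
  proof (rule ccontr)
    assume *: "\<not> ?thesis"
    have "Met_TC.mtopology interior_of (\<Union>(range C)) = {}"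
    proof (rule Met_TC.metric_Baire_category_alt)
      show "Met_TC.mcomplete TYPE('a)"
        unfolding Met_TC.mcomplete_def by (auto simp: Cauchy_convergent_iff convergent_def)
    qed (use * in \<open>auto simp: C_def\<close>)
    moreover have "\<Union>(range C) = UNIV"
    proof (rule UNIV_eq_I[symmetric])
      fix y
      obtain n where "norm (S y) \<le> real n"
        using real_arch_simple by blast
      then have "y \<in> C n"
        unfolding C_def by (intro subsetD[OF closure_subset]) simp
      then show "y \<in> \<Union>(range C)"
        by blast
    qed
    ultimately show False
      by simp
  qed
  then obtain n y0 where "y0 \<in> interior (C n)"
    by blast
  then obtain r where r: "0 < r" "ball y0 r \<subseteq> C n"
    by (meson mem_interior)
  \<comment> \<open>Symmetrization moves the ball to the origin: \<open>y\<close> is half of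
    \<open>(y0 + y) - (y0 - y)\<close>, and half the difference of two approximations keeps the
    bound \<open>n\<close>.\<close>
  have ball: "\<exists>a. norm (y - a) < e \<and> norm (S a) \<le> n" if "norm y < r" "0 < e" for y e
  proof -
    have "y0 + y \<in> C n" "y0 - y \<in> C n"
      using r(2) that by (auto simp: subset_iff dist_norm)
    then obtain a b where a: "norm (S a) \<le> n" "dist a (y0 + y) < e"
      and b: "norm (S b) \<le> n" "dist b (y0 - y) < e"
      using \<open>0 < e\<close> unfolding C_def closure_approachable by blast
    have "y - (1/2) *\<^sub>R (a - b) = (1/2) *\<^sub>R ((b - (y0 - y)) - (a - (y0 + y)))"
      by (simp add: algebra_simps) (simp flip: scaleR_left_distrib)
    then have "norm (y - (1/2) *\<^sub>R (a - b)) = norm ((b - (y0 - y)) - (a - (y0 + y))) / 2"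
      by simp
    also have "\<dots> < e"
      using a(2) b(2) norm_triangle_ineq4[of "b - (y0 - y)" "a - (y0 + y)"] by (simp add: dist_norm)
    finally have 1: "norm (y - (1/2) *\<^sub>R (a - b)) < e" .
    have "norm (S ((1/2) *\<^sub>R (a - b))) = norm (S a - S b) / 2"
      by (simp add: linear_diff[OF lin] linear_scale[OF lin])
    also have "\<dots> \<le> n"
      using a(1) b(1) norm_triangle_ineq4[of "S a" "S b"] by simp
    finally show ?thesis
      using 1 by blast
  qed
  \<comment> \<open>A nonzero \<open>y\<close> will be rescaled to norm \<open>r / 2\<close>, inside
    the ball; scaling back turns the bound \<open>n\<close> into \<open>c * norm y\<close>.\<close>
  define c where "c = 2 * n / r"
  have "0 \<le> c"
    using r(1) by (simp add: c_def)
  have "\<exists>a. norm (y - a) \<le> norm y / 2 \<and> norm (S a) \<le> c * norm y" for y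
  proof (cases "y = 0")
    case True
    then show ?thesis
      by (intro exI[of _ 0]) (simp add: linear_0[OF lin])
  next
    case False
    define t where "t = r / (2 * norm y)"
    have t: "0 < t"
      using False r(1) by (simp add: t_def)
    have "norm (t *\<^sub>R y) < r" "0 < t * norm y / 2"
      using False r(1) t by (simp_all add: t_def)
    then obtain a where a: "norm (t *\<^sub>R y - a) < t * norm y / 2" "norm (S a) \<le> n"
      using ball by blast
    have "norm (y - inverse t *\<^sub>R a) = norm (inverse t *\<^sub>R (t *\<^sub>R y - a))"
      using t by (simp add: algebra_simps)
    also have "\<dots> = inverse t * norm (t *\<^sub>R y - a)"
      using t by simp
    also have "\<dots> \<le> inverse t * (t * norm y / 2)"
      using a(1) t by (intro mult_left_mono) auto
    also have "\<dots> = norm y / 2"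
      using t by simp
    finally have 1: "norm (y - inverse t *\<^sub>R a) \<le> norm y / 2" .
    have "norm (S (inverse t *\<^sub>R a)) = inverse t * norm (S a)"
      using t by (simp add: linear_scale[OF lin])
    also have "\<dots> \<le> inverse t * n"
      using a(2) t by (intro mult_left_mono) auto
    also have "\<dots> = c * norm y"
      by (simp add: t_def c_def)
    finally show ?thesis
      using 1 by blast
  qed
  then obtain pick where pick: "\<And>y. norm (y - pick y) \<le> norm y / 2"
      "\<And>y. norm (S (pick y)) \<le> c * norm y"
    by metis
  have bound: "norm (S y) \<le> norm y * (2 * c)" for y
  proof -
    \<comment> \<open>\<open>rem k\<close> is what remains of \<open>y\<close> after
      \<open>k\<close> corrections. Each correction at least halves it, so the chosen pieces sum to
      \<open>y\<close>.\<close>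
    define rem where "rem k = ((\<lambda>z. z - pick z) ^^ k) y" for k
    have rem_le: "norm (rem k) \<le> norm y * (1/2) ^ k" for k
    proof (induction k)
      case (Suc k)
      then show ?case
        using pick(1)[of "rem k"] by (simp add: rem_def)
    qed (simp add: rem_def)
    have sum_pick: "(\<Sum>k<m. pick (rem k)) = y - rem m" for m
      by (induction m) (auto simp: rem_def)
    have "rem \<longlonglongrightarrow> 0"
    proof (rule Lim_null_comparison)
      show "\<forall>\<^sub>F k in sequentially. norm (rem k) \<le> norm y * (1/2) ^ k"
        using rem_le by simp
      show "(\<lambda>k. norm y * (1/2) ^ k) \<longlonglongrightarrow> 0"
        by (intro tendsto_mult_right_zero LIMSEQ_power_zero) simp
    qed
    then have lim: "(\<lambda>m. \<Sum>k<m. pick (rem k)) \<longlonglongrightarrow> y"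
      unfolding sum_pick using tendsto_diff[OF tendsto_const] by fastforce
    have S_le: "norm (S (pick (rem k))) \<le> c * norm y * (1/2) ^ k" for k
    proof -
      have "norm (S (pick (rem k))) \<le> c * norm (rem k)"
        by (rule pick(2))
      also have "\<dots> \<le> c * (norm y * (1/2) ^ k)"
        by (intro mult_left_mono rem_le) fact
      finally show ?thesis
        by (simp add: mult.assoc)
    qed
    have sums: "(\<lambda>k. c * norm y * (1/2) ^ k) sums (c * norm y * 2)"
      using sums_mult[OF geometric_sums[of "1/2::real"], of "c * norm y"] by simp
    have summ: "summable (\<lambda>k. norm (S (pick (rem k))))"
      using sums_summable[OF sums] by (rule summable_comparison_test') (simp add: S_le)
    have "(\<lambda>m. S (\<Sum>k<m. pick (rem k))) \<longlonglongrightarrow> (\<Sum>k. S (pick (rem k)))"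
      unfolding linear_sum[OF lin] by (rule summable_LIMSEQ[OF summable_norm_cancel[OF summ]])
    \<comment> \<open>The images of the pieces form an absolutely convergent series, so the graph
      hypothesis applies to the partial sums.\<close>
    then have "S y = (\<Sum>k. S (pick (rem k)))"
      by (rule graph[OF lim])
    also have "norm \<dots> \<le> (\<Sum>k. norm (S (pick (rem k))))"
      by (rule summable_norm[OF summ])
    also have "\<dots> \<le> (\<Sum>k. c * norm y * (1/2) ^ k)"
      by (rule suminf_le[OF S_le summ sums_summable[OF sums]])
    also have "\<dots> = c * norm y * 2"
      by (rule sums_unique[OF sums, symmetric])
    finally show ?thesis
      by (simp add: mult_ac)
  qed
  show ?thesis
    by (rule bounded_linear_intro[OF _ _ bound]) (auto simp: linear_add[OF lin] linear_scale[OF lin])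
qed

section \<open>Bases and linear maps\<close>

text \<open>Coefficients over \<open>A \<union> B\<close> are unique; those of \<open>x\<close>
  vanish off \<open>A\<close> and off \<open>B\<close>, hence everywhere.\<close>

lemma (in vector_space) span_disjoint_independent:
  assumes ind: "independent (A \<union> B)" and disj: "A \<inter> B = {}" and x: "x \<in> span A" "x \<in> span B"
  shows "x = 0"
proof -
  have "representation (A \<union> B) x = representation A x" "representation (A \<union> B) x = representation B x"
    by (rule representation_extend[OF ind]; use x in simp)+
  then have "representation A x b = 0" for b
    using disj representation_ne_zero[of A x b] representation_ne_zero[of B x b] by fastforce
  moreover have "independent A"
    using ind independent_mono by blast
  ultimately show ?thesis
    using sum_nonzero_representation_eq[of A x] x by simp
qed

text \<open>The spanning set in \<open>finite_dim\<close> may lie outside \<open>S\<close>; a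
  maximal independent subset of \<open>S\<close> is finite by the exchange bound.\<close>

lemma (in vector_space) finite_dim_basis:
  assumes "finite_dim scale S"
  obtains B where "finite B" "independent B" "B \<subseteq> S" "S \<subseteq> span B"
proof -
  obtain W where W: "finite W" "S \<subseteq> span W"
    using assms unfolding finite_dim_def by blast
  obtain B where B: "B \<subseteq> S" "independent B" "S \<subseteq> span B"
    using maximal_independent_subset by blast
  moreover have "finite B"
    using independent_span_bound[OF W(1) B(2)] B(1) W(2) by blast
  ultimately show ?thesis
    using that by blast
qed

text \<open>The cardinalities agree because R has two bases of the form W + W' and L(W') + V: the first
  extends a basis of the kernel, the second extends the image of the vectors added there.\<close>

lemma (in vector_space) kernel_cokernel_bases:
  assumes L: "Vector_Spaces.linear scale scale L"
    and R: "subspace R" "finite_dim scale R"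
    and LR: "\<And>x. L x \<in> R \<longleftrightarrow> x \<in> R"
  obtains W V where "finite W" "independent W" "span W = {x. L x = 0}"
    "finite V" "independent V" "V \<subseteq> R" "span V \<inter> range L \<subseteq> {0}" "R \<subseteq> span (range L \<union> V)"
    "card V = card W"
proof -
  interpret L: Vector_Spaces.linear scale scale L by (rule L)
  obtain E where E: "finite E" "R \<subseteq> span E"
    using R(2) unfolding finite_dim_def by blast
  have fin: "finite B" if "B \<subseteq> R" "independent B" for B
    using independent_span_bound[OF E(1) that(2)] that(1) E(2) by blast
  let ?N = "{x. L x = 0}"
  have N: "subspace ?N" "?N \<subseteq> R"
  proof -
    show "?N \<subseteq> R"
    proof
      fix x assume "x \<in> ?N"
      then have "L x \<in> R"
        using subspace_0[OF R(1)] by simp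
      then show "x \<in> R"
        using LR by simp
    qed
  qed (rule L.subspace_kernel)
  obtain W where W: "W \<subseteq> ?N" "independent W" "?N \<subseteq> span W"
    using maximal_independent_subset by blast
  obtain B where B: "W \<subseteq> B" "B \<subseteq> R" "independent B" "R \<subseteq> span B"
    using maximal_independent_subset_extend[of W R] W N by blast
  define W' where "W' = B - W"
  have WW': "W \<union> W' = B" "W \<inter> W' = {}"
    using B(1) by (auto simp: W'_def)
  \<comment> \<open>\<open>W\<close> spans the kernel and \<open>W \<union> W'\<close> is
    independent, so the kernel meets \<open>span W'\<close> only in zero.\<close>
  have inj: "inj_on L (span W')"
    unfolding L.inj_on_iff_eq_0[OF subspace_span]
  proof (intro ballI impI)
    fix x assume "x \<in> span W'" "L x = 0"
    then show "x = 0"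
      using span_disjoint_independent[of W W' x] WW' B(3) W(3) by auto
  qed
  have ind': "independent W'"
    using B(3) WW' independent_mono by blast
  have ind: "independent (L ` W')"
    by (rule L.independent_injective_image[OF ind' inj])
  have sub: "L ` W' \<subseteq> R"
    using B(2) LR by (auto simp: W'_def)
  have LWR: "L x \<in> span (L ` W')" if "x \<in> R" for x
  proof -
    have "L x \<in> L ` span B"
      using that B(4) by blast
    also have "\<dots> = span (L ` B)"
      by (rule L.span_image[symmetric])
    also have "\<dots> \<subseteq> span (L ` W')"
    proof (rule span_minimal)
      show "L ` B \<subseteq> span (L ` W')"
        using W(1) WW'(1) span_zero by (auto intro: span_base)
    qed simp
    finally show ?thesis .
  qed
  obtain C where C: "L ` W' \<subseteq> C" "C \<subseteq> R" "independent C" "R \<subseteq> span C"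
    using maximal_independent_subset_extend[OF sub ind] by blast
  define V where "V = C - L ` W'"
  have CV: "L ` W' \<union> V = C" "L ` W' \<inter> V = {}"
    using C(1) by (auto simp: V_def)
  have "card C = card B"
    using basis_card_eq_dim[OF C(2,4,3)] basis_card_eq_dim[OF B(2,4,3)] by simp
  moreover have "card C = card (L ` W') + card V"
    unfolding CV(1)[symmetric]
    by (rule card_Un_disjoint) (use fin[OF C(2,3)] CV in \<open>auto intro: finite_subset\<close>)
  moreover have "card (L ` W') = card W'"
    by (rule card_image) (rule inj_on_subset[OF inj span_superset])
  moreover have "card B = card W + card W'"
    unfolding WW'(1)[symmetric]
    by (rule card_Un_disjoint) (use fin[OF B(2,3)] WW' in \<open>auto intro: finite_subset\<close>)
  ultimately have "card V = card W"
    by simp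
  moreover have "span V \<inter> range L \<subseteq> {0}"
  proof clarify
    fix x assume x: "L x \<in> span V"
    \<comment> \<open>\<open>L x\<close> lies in \<open>R\<close>, so \<open>x\<close> does by
      \<open>LR\<close>. Hence \<open>L x\<close> is in the span of the images of \<open>W'\<close>,
      which meets \<open>span V\<close> only in zero.\<close>
    then have "x \<in> R"
      using LR span_minimal[of V R] C(2) R(1) V_def by auto
    then show "L x = 0"
      using span_disjoint_independent[of "L ` W'" V "L x"] CV C(3) LWR x by auto
  qed
  moreover have "R \<subseteq> span (range L \<union> V)"
    using C(4) span_mono[of C "range L \<union> V"] CV(1) by blast
  moreover have "V \<subseteq> C"
    by (auto simp: V_def)
  then have "finite V" "independent V" "V \<subseteq> R"
    using fin[OF C(2,3)] C(2) independent_mono[OF C(3)] by (blast intro: finite_subset)+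
  moreover have "finite W"
    using finite_subset[OF B(1) fin[OF B(2,3)]] .
  moreover have "span W = ?N"
    by (rule span_subspace[OF W(1,3) N(1)])
  ultimately show ?thesis
    using W(2) by - (rule that[of W V])
qed

text \<open>Preimages \<open>E\<close> of a finite spanning set of the range suffice: each
  \<open>y\<close> has the same image as some \<open>e \<in> span E\<close>, so \<open>y - e\<close>
  is in the kernel.\<close>

lemma (in vector_space) finite_codim_kernel:
  assumes K: "Vector_Spaces.linear scale scale K" and fin: "finite_dim scale (range K)"
  obtains E where "finite E" "span ({x. K x = 0} \<union> E) = UNIV"
proof -
  interpret K: Vector_Spaces.linear scale scale K by (rule K)
  obtain B where B: "finite B" "B \<subseteq> range K" "range K \<subseteq> span B"
    by (rule finite_dim_basis[OF fin])
  obtain E where E: "finite E" "B = K ` E"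
    using finite_subset_image[OF B(1,2)] by blast
  have "y \<in> span ({x. K x = 0} \<union> E)" for y
  proof -
    have "K y \<in> K ` span E"
      using B(3) unfolding E(2) K.span_image by blast
    then obtain e where e: "e \<in> span E" "K (y - e) = 0"
      by (auto simp: K.diff)
    have "y - e \<in> span ({x. K x = 0} \<union> E)" "e \<in> span ({x. K x = 0} \<union> E)"
      using e span_mono[of E "{x. K x = 0} \<union> E"] by (auto intro: span_base)
    from span_add[OF this] show ?thesis
      by simp
  qed
  then show ?thesis
    using that E(1) by blast
qed

section \<open>Separation and finite complements in Banach spaces\<close>

context banach_space_over
begin

lemma real_subspace: "subspace M \<Longrightarrow> real_vector.subspace M"
  unfolding real_vector.subspace_def subspace_def by (metis scale_of_real)

lemma scaleR_eq: "r *\<^sub>R x = s (of_real r) x"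
  by (simp add: scale_of_real)

lemma bounded_linear_scale_right: "bounded_linear (s c)"
  by (rule bounded_linear_intro[where K = "norm c"])
    (simp_all add: scaleR_eq algebra_simps norm_scale)

lemma bounded_linear_scale_left: "bounded_linear (\<lambda>c. s c x)"
  by (rule bounded_linear_intro[where K = "norm x"])
    (simp_all add: scaleR_eq algebra_simps norm_scale scaleR_conv_of_real)

lemma vector_space_scalars: "vector_space ((*) :: 'k \<Rightarrow> 'k \<Rightarrow> 'k)"
  using banach_space_over_scalars unfolding banach_space_over_def by blast

lemma dual_space_iff:
  "f \<in> dual_space s \<longleftrightarrow> (\<forall>c x. blinfun_apply f (s c x) = c * blinfun_apply f x)"
  by (auto simp: dual_space_def bounded_operator_def Vector_Spaces.linear_iff blinfun.add_right
      vector_space_axioms vector_space_scalars blinfun.bounded_linear_right)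

text \<open>Composition with a fixed nonzero real functional t of the scalar field identifies the
  scalar-linear functionals with the real-linear ones, because the form t(a b) is nondegenerate;
  so the real separation theorem suffices.\<close>

lemma Hahn_Banach_separation:
  assumes M: "subspace M" "closed M" and x0: "x0 \<notin> M"
  obtains f where "f \<in> dual_space s" "\<And>x. x \<in> M \<Longrightarrow> blinfun_apply f x = 0" "blinfun_apply f x0 = 1"
proof -
  obtain \<phi> where \<phi>: "bounded_linear \<phi>" "\<And>x. x \<in> M \<Longrightarrow> \<phi> x = (0::real)" "\<phi> x0 \<noteq> 0"
    using Hahn_Banach_separation_real[OF real_subspace[OF M(1)] M(2) x0] by blast
  \<comment> \<open>For the complex numbers, \<open>t\<close> is the real part.\<close>
  define t where "t a = inner a (1::'k)" for a
  have t: "linear t" "t 0 = 0"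
    unfolding t_def by (auto intro!: linearI simp: inner_left_distrib)
  have t_mult_right: "linear (\<lambda>b. t (a * b))" and t_mult_left: "linear (\<lambda>b. t (b * a))" for a
    by (auto intro!: linearI simp: algebra_simps linear_add[OF t(1)] linear_scale[OF t(1)])
  have nondeg: "b = 0" if "\<And>a. t (a * b) = 0" for b
  proof (rule ccontr)
    assume "b \<noteq> 0"
    then have "t (inverse b * b) \<noteq> 0"
      by (simp add: t_def)
    then show False
      using that by blast
  qed
  \<comment> \<open>The coordinates \<open>t (i * b)\<close> encode the functional sending
    \<open>a\<close> to \<open>t (a * b)\<close>. Nondegeneracy makes \<open>T\<close> injective,
    hence surjective in finite dimension.\<close>
  define T where "T b = (\<Sum>i\<in>Basis. t (i * b) *\<^sub>R i)" for b
  have T_inner: "inner (T b) i = t (i * b)" if "i \<in> Basis" for b i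
    using that by (simp add: T_def)
  have T: "linear T"
  proof (rule linearI)
    show "T (b + c) = T b + T c" for b c
      by (simp only: T_def linear_add[OF t_mult_right] scaleR_left_distrib sum.distrib)
    show "T (r *\<^sub>R b) = r *\<^sub>R T b" for r b
      by (simp add: T_def linear_scale[OF t_mult_right] scaleR_sum_right del: mult_scaleR_right)
  qed
  have ext: "t (a * b) = \<psi> a" if "linear \<psi>" "\<And>i. i \<in> Basis \<Longrightarrow> t (i * b) = \<psi> i" for a b \<psi>
    using linear_eq_stdbasis[OF t_mult_left that(1)] that(2) by metis
  have "inj T"
    unfolding linear_injective_0[OF T]
  proof (intro allI impI)
    fix b assume "T b = 0"
    then have "t (i * b) = 0" if "i \<in> Basis" for i
      using T_inner[OF that, of b] by simp
    then show "b = 0"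
      using nondeg ext[OF linear_zero, of b] by blast
  qed
  then have "surj T"
    by (rule linear_injective_imp_surjective[OF T]) (rule refl)
  then obtain G where G: "linear G" "T \<circ> G = id"
    using linear_surjective_right_inverse[OF T] by blast
  \<comment> \<open>\<open>f x\<close> is the scalar that represents, through \<open>t\<close>, the
    real functional sending \<open>a\<close> to \<open>\<phi> (s a x)\<close>.\<close>
  define f where "f x = G (\<Sum>i\<in>Basis. \<phi> (s i x) *\<^sub>R i)" for x
  have tf: "t (a * f x) = \<phi> (s a x)" for a x
  proof (rule ext)
    show "linear (\<lambda>a. \<phi> (s a x))"
      using bounded_linear_compose[OF \<phi>(1) bounded_linear_scale_left]
      by (simp add: bounded_linear.linear)
    fix i :: 'k assume i: "i \<in> Basis"
    have "T (f x) = (\<Sum>i\<in>Basis. \<phi> (s i x) *\<^sub>R i)"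
      using G(2) by (simp add: f_def fun_eq_iff)
    then show "t (i * f x) = \<phi> (s i x)"
      using T_inner[OF i, of "f x"] i by simp
  qed
  have unique: "c = d" if "\<And>a. t (a * c) = t (a * d)" for c d
    using nondeg[of "c - d"] that by (simp add: right_diff_distrib linear_diff[OF t(1)])
  have "bounded_linear G"
    using G(1) by (simp add: linear_conv_bounded_linear)
  moreover have "bounded_linear (\<lambda>x. \<Sum>i\<in>Basis. \<phi> (s i x) *\<^sub>R i)"
    by (intro bounded_linear_sum bounded_linear_compose[OF bounded_linear_scaleR_left]
        bounded_linear_compose[OF \<phi>(1)] bounded_linear_scale_right)
  ultimately have bl: "bounded_linear f"
    unfolding f_def by (rule bounded_linear_compose)
  \<comment> \<open>Both sides represent the functional sending \<open>a\<close> to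
    \<open>\<phi> (s (a * c) x)\<close>.\<close>
  have scale: "f (s c x) = c * f x" for c x
    by (rule unique) (simp add: tf flip: mult.assoc)
  have zero: "f x = 0" if "x \<in> M" for x
    by (rule unique) (use that in \<open>simp add: tf \<phi>(2) subspace_scale[OF M(1)] t(2)\<close>)
  have "f x0 \<noteq> 0"
    using tf[of 1 x0] \<phi>(3) t(2) by auto
  let ?g = "dual_scale (inverse (f x0)) (Blinfun f)"
  have g: "blinfun_apply ?g x = inverse (f x0) * f x" for x
    by (simp add: bounded_linear_Blinfun_apply[OF bl])
  show ?thesis
  proof
    show "?g \<in> dual_space s"
      unfolding dual_space_iff g by (simp add: scale)
  qed (use \<open>f x0 \<noteq> 0\<close> zero in \<open>simp_all add: bounded_linear_Blinfun_apply[OF bl]\<close>)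
qed

text \<open>A functional that vanishes on \<open>span S\<close> and is 1 at \<open>v\<close> reads
  off the coefficient of \<open>v\<close>. So the larger span is the preimage of
  \<open>span S\<close> under the continuous map subtracting that multiple of
  \<open>v\<close>.\<close>

lemma closed_span_insert:
  assumes "closed (span S)"
  shows "closed (span (insert v S))"
proof (cases "v \<in> span S")
  case True
  then show ?thesis
    using assms by (simp add: span_redundant)
next
  case False
  then obtain f where f: "f \<in> dual_space s" "\<And>x. x \<in> span S \<Longrightarrow> blinfun_apply f x = 0"
      "blinfun_apply f v = 1"
    using Hahn_Banach_separation[OF subspace_span assms] by blast
  have "k = blinfun_apply f x" if "x - s k v \<in> span S" for k x
    using f(2)[OF that] f(1,3) by (simp add: blinfun.diff_right dual_space_iff)
  then have "span (insert v S) = (\<lambda>x. x - s (blinfun_apply f x) v) -` span S"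
    unfolding span_insert by blast
  moreover have "closed \<dots>"
    by (intro closed_vimage assms continuous_intros
        bounded_linear.continuous_on[OF bounded_linear_scale_left])
  ultimately show ?thesis
    by simp
qed

lemma closed_span_Un_finite:
  assumes "finite V" "subspace M" "closed M"
  shows "closed (span (M \<union> V))"
  using assms(1)
proof (induction V)
  case empty
  then show ?case
    using assms by (simp add: span_eq_iff[THEN iffD2])
next
  case (insert v V)
  then show ?case
    using closed_span_insert by simp
qed

section \<open>Annihilators and dual systems\<close>

definition annihilator :: "'a set \<Rightarrow> ('a \<Rightarrow>\<^sub>L 'k) set" where
  "annihilator M = {f \<in> dual_space s. \<forall>x\<in>M. blinfun_apply f x = 0}"

text \<open>A dual system for \<open>V\<close> modulo \<open>M\<close>; its existence makes
  \<open>V\<close> independent modulo \<open>M\<close>. The values of \<open>g\<close> outside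
  \<open>V\<close> are arbitrary.\<close>

definition biorthogonal :: "'a set \<Rightarrow> 'a set \<Rightarrow> ('a \<Rightarrow> ('a \<Rightarrow>\<^sub>L 'k)) \<Rightarrow> bool" where
  "biorthogonal M V g \<longleftrightarrow> finite V \<and> (\<forall>v\<in>V. g v \<in> annihilator M) \<and>
     (\<forall>v\<in>V. \<forall>w\<in>V. blinfun_apply (g v) w = (if v = w then 1 else 0))"

text \<open>Separating \<open>x\<close> from the closed space \<open>span (M \<union> V)\<close>
  gives its functional \<open>f\<close>. Subtracting the multiple
  \<open>blinfun_apply (g v) x\<close> of \<open>f\<close> makes \<open>g v\<close> vanish at
  \<open>x\<close> and changes nothing on \<open>M\<close> and \<open>V\<close>, where
  \<open>f\<close> is zero.\<close>

lemma biorthogonal_insert: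
  assumes g: "biorthogonal M V g" and M: "subspace M" "closed M" and x: "x \<notin> span (M \<union> V)"
  shows "\<exists>g'. biorthogonal M (insert x V) g'"
proof -
  have fin: "finite V" and g_ann: "\<And>v. v \<in> V \<Longrightarrow> g v \<in> annihilator M"
    and delta: "\<And>v w. v \<in> V \<Longrightarrow> w \<in> V \<Longrightarrow> blinfun_apply (g v) w = (if v = w then 1 else 0)"
    using g by (auto simp: biorthogonal_def)
  obtain f where f: "f \<in> dual_space s" "\<And>y. y \<in> span (M \<union> V) \<Longrightarrow> blinfun_apply f y = 0"
      "blinfun_apply f x = 1"
    using Hahn_Banach_separation[OF subspace_span closed_span_Un_finite[OF fin M] x] by blast
  have fM: "blinfun_apply f y = 0" if "y \<in> M \<union> V" for y
    using f(2) that span_base by blast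
  define g' where "g' v = (if v = x then f else g v - dual_scale (blinfun_apply (g v) x) f)" for v
  have "x \<notin> V"
    using x span_base by blast
  have "g' v \<in> annihilator M" if "v \<in> insert x V" for v
    using that g_ann[of v] f(1) fM
    by (auto simp: g'_def annihilator_def dual_space_iff blinfun.diff_left algebra_simps)
  moreover have "blinfun_apply (g' v) w = (if v = w then 1 else 0)"
    if "v \<in> insert x V" "w \<in> insert x V" for v w
    using that \<open>x \<notin> V\<close> fM f(3) delta by (auto simp: g'_def blinfun.diff_left)
  ultimately have "biorthogonal M (insert x V) g'"
    using fin unfolding biorthogonal_def by blast
  then show ?thesis
    by blast
qed

lemma biorthogonal_exists:
  assumes "finite V" "independent V" "span V \<inter> M \<subseteq> {0}" and M: "subspace M" "closed M"
  shows "\<exists>g. biorthogonal M V g"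
  using assms(1-3)
proof (induction V)
  case empty
  then show ?case
    by (simp add: biorthogonal_def)
next
  case (insert x V)
  have V: "independent V" "x \<notin> span V"
    using insert.prems(1) insert.hyps(2) by (auto simp: independent_insert)
  have "span V \<subseteq> span (insert x V)"
    by (rule span_mono) blast
  then obtain g where g: "biorthogonal M V g"
    using insert.IH[OF V(1)] insert.prems(2) by blast
  \<comment> \<open>If \<open>x = m + z\<close>, then \<open>m = x - z\<close> lies both in
    \<open>M\<close> and in the span of \<open>insert x V\<close>. So \<open>m\<close> is zero, and
    \<open>x = z\<close> contradicts independence.\<close>
  have "x \<notin> span (M \<union> V)"
  proof
    assume "x \<in> span (M \<union> V)"
    then obtain m z where mz: "x = m + z" "m \<in> span M" "z \<in> span V"
      unfolding span_Un by blast
    then have "m \<in> M"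
      using M(1) by (simp add: span_eq_iff[THEN iffD2])
    moreover have "m = x - z"
      using mz(1) by simp
    moreover have "x - z \<in> span (insert x V)"
      using mz(3) \<open>span V \<subseteq> _\<close> by (intro span_diff) (auto intro: span_base)
    ultimately have "m = 0"
      using insert.prems(2) by blast
    then show False
      using mz V(2) by simp
  qed
  then show ?case
    by (rule biorthogonal_insert[OF g M])
qed

text \<open>The linear map \<open>?P\<close> fixes \<open>M\<close> and kills \<open>V\<close>, so
  the vectors that it sends into \<open>M\<close> form a subspace containing both.\<close>

lemma biorthogonal_expansion:
  assumes g: "biorthogonal M V g" and M: "subspace M" and x: "x \<in> span (M \<union> V)"
  shows "x - (\<Sum>v\<in>V. s (blinfun_apply (g v) x) v) \<in> M"
proof -
  let ?P = "\<lambda>x. x - (\<Sum>v\<in>V. s (blinfun_apply (g v) x) v)"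
  have fin: "finite V" and g_ann: "\<And>v. v \<in> V \<Longrightarrow> g v \<in> annihilator M"
    and delta: "\<And>v w. v \<in> V \<Longrightarrow> w \<in> V \<Longrightarrow> blinfun_apply (g v) w = (if v = w then 1 else 0)"
    using g by (auto simp: biorthogonal_def)
  have add: "?P (x + y) = ?P x + ?P y" for x y
    by (simp add: blinfun.add_right scale_left_distrib sum.distrib)
  have scale: "?P (s c x) = s c (?P x)" for c x
  proof -
    have "(\<Sum>v\<in>V. s (blinfun_apply (g v) (s c x)) v) = s c (\<Sum>v\<in>V. s (blinfun_apply (g v) x) v)"
      unfolding scale_sum_right using g_ann by (intro sum.cong) (auto simp: annihilator_def dual_space_iff)
    then show ?thesis
      by (simp add: scale_right_diff_distrib)
  qed
  have "subspace {x. ?P x \<in> M}"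
  proof (rule subspaceI)
    show "0 \<in> {x. ?P x \<in> M}"
      using subspace_0[OF M] by simp
    show "x + y \<in> {x. ?P x \<in> M}" if "x \<in> {x. ?P x \<in> M}" "y \<in> {x. ?P x \<in> M}" for x y
      using subspace_add[OF M, of "?P x" "?P y"] that unfolding mem_Collect_eq add by blast
    show "s c x \<in> {x. ?P x \<in> M}" if "x \<in> {x. ?P x \<in> M}" for c x
      using subspace_scale[OF M, of "?P x" c] that unfolding mem_Collect_eq scale by blast
  qed
  moreover have "M \<union> V \<subseteq> {x. ?P x \<in> M}"
  proof
    fix y assume "y \<in> M \<union> V"
    then consider "y \<in> M" | "y \<in> V"
      by blast
    then show "y \<in> {x. ?P x \<in> M}"
    proof cases
      case 1
      then have "(\<Sum>v\<in>V. s (blinfun_apply (g v) y) v) = 0"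
        using g_ann by (intro sum.neutral) (auto simp: annihilator_def)
      with 1 show ?thesis
        by simp
    next
      case 2
      have "(\<Sum>v\<in>V. s (blinfun_apply (g v) y) v) = (\<Sum>v\<in>V. if v = y then v else 0)"
        using 2 by (intro sum.cong) (auto simp: delta)
      also have "\<dots> = y"
        using 2 fin by simp
      finally show ?thesis
        using subspace_0[OF M] by simp
    qed
  qed
  ultimately show ?thesis
    using span_minimal[of "M \<union> V"] x by blast
qed

text \<open>Evaluating a vanishing combination at \<open>w\<close> leaves only the coefficient of
  \<open>g w\<close>.\<close>

lemma biorthogonal_independent:
  assumes g: "biorthogonal M V g"
  shows "inj_on g V" "\<not> module.dependent dual_scale (g ` V)"
proof -
  interpret D: vector_space dual_scale by (rule vector_space_dual_scale)
  have fin: "finite V"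
    and delta: "\<And>v w. v \<in> V \<Longrightarrow> w \<in> V \<Longrightarrow> blinfun_apply (g v) w = (if v = w then 1 else 0)"
    using g by (auto simp: biorthogonal_def)
  show inj: "inj_on g V"
  proof (rule inj_onI)
    fix v w assume "v \<in> V" "w \<in> V" "g v = g w"
    then show "v = w"
      using delta[of v w] delta[of w w] by (auto split: if_splits)
  qed
  show "D.independent (g ` V)"
  proof (rule D.independent_if_scalars_zero)
    fix u f assume sum: "(\<Sum>f\<in>g ` V. dual_scale (u f) f) = 0" and "f \<in> g ` V"
    then obtain w where w: "w \<in> V" "f = g w"
      by blast
    have "0 = (\<Sum>v\<in>V. blinfun_apply (dual_scale (u (g v)) (g v)) w)"
      using arg_cong[OF sum, of "\<lambda>f. blinfun_apply f w"] by (simp add: sum.reindex[OF inj] blinfun.sum_left)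
    also have "\<dots> = (\<Sum>v\<in>V. if v = w then u (g v) else 0)"
      using w by (intro sum.cong) (auto simp: delta)
    also have "\<dots> = u f"
      using w fin by simp
    finally show "u f = 0"
      by simp
  qed (use fin in simp)
qed

text \<open>The functionals \<open>g v\<close> form a basis of the annihilator: by the expansion
  modulo \<open>M\<close>, a functional vanishing on \<open>M\<close> is their combination with its
  values on \<open>V\<close> as coefficients.\<close>

lemma dim_annihilator:
  assumes g: "biorthogonal M V g" and M: "subspace M" and span: "span (M \<union> V) = UNIV"
  shows "finite_dim dual_scale (annihilator M)"
    "vector_space.dim dual_scale (annihilator M) = card V"
proof -
  interpret D: vector_space dual_scale by (rule vector_space_dual_scale)
  have fin: "finite V" and g_ann: "g ` V \<subseteq> annihilator M"
    using g by (auto simp: biorthogonal_def)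
  have ann: "annihilator M \<subseteq> D.span (g ` V)"
  proof
    fix f assume "f \<in> annihilator M"
    then have f: "f \<in> dual_space s" "\<And>x. x \<in> M \<Longrightarrow> blinfun_apply f x = 0"
      by (auto simp: annihilator_def)
    have "f = (\<Sum>v\<in>V. dual_scale (blinfun_apply f v) (g v))"
    proof (rule blinfun_eqI)
      fix x
      have "blinfun_apply f (x - (\<Sum>v\<in>V. s (blinfun_apply (g v) x) v)) = 0"
        by (rule f(2)[OF biorthogonal_expansion[OF g M]]) (simp add: span)
      then show "blinfun_apply f x = blinfun_apply (\<Sum>v\<in>V. dual_scale (blinfun_apply f v) (g v)) x"
        using f(1) by (simp add: blinfun.diff_right blinfun.sum_right blinfun.sum_left dual_space_iff mult.commute)
    qed
    also have "\<dots> \<in> D.span (g ` V)"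
      by (intro D.span_sum D.span_scale D.span_base) simp
    finally show "f \<in> D.span (g ` V)" .
  qed
  then show "finite_dim dual_scale (annihilator M)"
    unfolding finite_dim_def using fin by blast
  have "card (g ` V) = D.dim (annihilator M)"
    by (rule D.basis_card_eq_dim[OF g_ann ann biorthogonal_independent(2)[OF g]])
  then show "D.dim (annihilator M) = card V"
    using card_image[OF biorthogonal_independent(1)[OF g]] by simp
qed

text \<open>The functionals of a dual system are independent in the annihilator, so such systems
  have bounded size. A largest one spans the space together with \<open>M\<close>, since any
  \<open>x\<close> outside could be inserted.\<close>

lemma finite_codim_if_annihilator:
  assumes M: "subspace M" "closed M" and fin: "finite_dim dual_scale (annihilator M)"
  obtains V g where "biorthogonal M V g" "span (M \<union> V) = UNIV"
proof -
  interpret D: vector_space dual_scale by (rule vector_space_dual_scale)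
  obtain W where W: "finite W" "annihilator M \<subseteq> D.span W"
    using fin unfolding finite_dim_def by blast
  have bound: "card V \<le> card W" if g: "biorthogonal M V g" for V g
  proof -
    have "g ` V \<subseteq> D.span W"
      using g W(2) by (auto simp: biorthogonal_def)
    then have "card (g ` V) \<le> card W"
      using D.independent_span_bound[OF W(1) biorthogonal_independent(2)[OF g]] by blast
    then show ?thesis
      using card_image[OF biorthogonal_independent(1)[OF g]] by simp
  qed
  have "\<exists>g. biorthogonal M {} g"
    by (simp add: biorthogonal_def)
  then obtain V where V: "\<exists>g. biorthogonal M V g"
    and max: "\<And>V'. \<exists>g. biorthogonal M V' g \<Longrightarrow> card V' \<le> card V"
    using ex_has_greatest_nat[of "\<lambda>V. \<exists>g. biorthogonal M V g" "{}" card "Suc (card W)"] bound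
    by (auto simp: less_Suc_eq_le)
  obtain g where g: "biorthogonal M V g"
    using V by blast
  have "x \<in> span (M \<union> V)" for x
  proof (rule ccontr)
    assume x: "x \<notin> span (M \<union> V)"
    then have "card (insert x V) \<le> card V"
      using max biorthogonal_insert[OF g M] by blast
    moreover have "x \<notin> V" "finite V"
      using x g span_base by (auto simp: biorthogonal_def)
    ultimately show False
      by simp
  qed
  then show ?thesis
    using that g by blast
qed

end

section \<open>Fredholm operators\<close>

lemma dom_op_diff [simp]: "dom (op_diff B F) = dom B"
  by (auto simp: op_diff_def dom_def)

lemma op_diff_eq_Some_iff: "op_diff B F u = Some w \<longleftrightarrow> (\<exists>v. B u = Some v \<and> w = v - F u)"
  by (auto simp: op_diff_def)

text \<open>The graph of the difference is the preimage of the graph of \<open>B\<close> under the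
  continuous map sending \<open>(u, w)\<close> to \<open>(u, w + F u)\<close>.\<close>

lemma closed_operator_op_diff:
  fixes B :: "'a::topological_space \<rightharpoonup> 'b::real_normed_vector"
  assumes B: "closed_operator B" and F: "continuous_on UNIV F"
  shows "closed_operator (op_diff B F)"
proof -
  have "Map.graph (op_diff B F) = (\<lambda>p. (fst p, snd p + F (fst p))) -` Map.graph B"
    by (auto simp: Map.graph_def op_diff_eq_Some_iff)
  moreover have "closed \<dots>"
    using B unfolding closed_operator_def
    by (intro closed_vimage continuous_intros continuous_on_compose2[OF F]) auto
  ultimately show ?thesis
    by (simp add: closed_operator_def)
qed

section \<open>Linear operators between two Banach spaces\<close>

locale banach_space_pair = X: banach_space_over sX + Y: banach_space_over sY
  for sX :: "'k::{real_normed_field, euclidean_space} \<Rightarrow> 'x::banach \<Rightarrow> 'x"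
    and sY :: "'k \<Rightarrow> 'y::banach \<Rightarrow> 'y"
begin

text \<open>An equation with \<open>Some\<close> states membership in the domain and the value at
  once, which spares most later arguments \<open>dom\<close> and \<open>the\<close>.\<close>

lemma linear_operator_iff:
  "linear_operator sX sY A \<longleftrightarrow> A 0 = Some 0 \<and>
     (\<forall>u v y z. A u = Some y \<longrightarrow> A v = Some z \<longrightarrow> A (u + v) = Some (y + z)) \<and>
     (\<forall>c u y. A u = Some y \<longrightarrow> A (sX c u) = Some (sY c y))" (is "_ \<longleftrightarrow> ?R")
proof
  assume A: "linear_operator sX sY A"
  then have sub: "X.subspace (dom A)"
    and add: "\<And>u v. u \<in> dom A \<Longrightarrow> v \<in> dom A \<Longrightarrow> the (A (u + v)) = the (A u) + the (A v)"
    and scale: "\<And>c u. u \<in> dom A \<Longrightarrow> the (A (sX c u)) = sY c (the (A u))"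
    by (auto simp: linear_operator_def)
  have add': "A (u + v) = Some (y + z)" if "A u = Some y" "A v = Some z" for u v y z
    using add[of u v] X.subspace_add[OF sub, of u v] that by (fastforce simp: dom_def)
  have scale': "A (sX c u) = Some (sY c y)" if "A u = Some y" for c u y
    using scale[of u c] X.subspace_scale[OF sub, of u c] that by (fastforce simp: dom_def)
  obtain y where "A 0 = Some y"
    using X.subspace_0[OF sub] by blast
  then have "A 0 = Some 0"
    using scale'[of 0 y 0] by simp
  then show ?R
    using add' scale' by blast
next
  assume A: ?R
  then have "A (u + v) = Some (y + z)" if "A u = Some y" "A v = Some z" for u v y z
    using that by blast
  moreover have "A (sX c u) = Some (sY c y)" if "A u = Some y" for c u y
    using A that by blast
  moreover have "A 0 = Some 0"
    using A by blast
  ultimately show "linear_operator sX sY A"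
    unfolding linear_operator_def X.subspace_def by (auto simp: dom_def)
qed

lemma linear_operatorD:
  assumes "linear_operator sX sY A"
  shows "A 0 = Some 0" "A u = Some y \<Longrightarrow> A v = Some z \<Longrightarrow> A (u + v) = Some (y + z)"
    "A u = Some y \<Longrightarrow> A (sX c u) = Some (sY c y)"
    "A u = Some y \<Longrightarrow> A v = Some z \<Longrightarrow> A (u - v) = Some (y - z)"
proof -
  show *: "A 0 = Some 0" "A u = Some y \<Longrightarrow> A v = Some z \<Longrightarrow> A (u + v) = Some (y + z)"
    "A u = Some y \<Longrightarrow> A (sX c u) = Some (sY c y)" for u v y z c
    using assms unfolding linear_operator_iff by blast+
  show "A u = Some y \<Longrightarrow> A v = Some z \<Longrightarrow> A (u - v) = Some (y - z)"
    using *(2)[of u y "sX (- 1) v" "sY (- 1) z"] *(3)[of v z "- 1"] by simp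
qed

lemma linear_operator_op_diff:
  assumes B: "linear_operator sX sY B" and F: "Vector_Spaces.linear sX sY F"
  shows "linear_operator sX sY (op_diff B F)"
proof -
  interpret F: Vector_Spaces.linear sX sY F by (rule F)
  show ?thesis
    unfolding linear_operator_iff op_diff_eq_Some_iff
  proof (intro conjI allI impI)
    show "\<exists>v. B 0 = Some v \<and> 0 = v - F 0"
      using linear_operatorD(1)[OF B] by simp
  next
    fix u v y z
    assume "\<exists>v. B u = Some v \<and> y = v - F u" "\<exists>w. B v = Some w \<and> z = w - F v"
    then obtain y' z' where "B u = Some y'" "y = y' - F u" "B v = Some z'" "z = z' - F v"
      by blast
    then show "\<exists>w. B (u + v) = Some w \<and> y + z = w - F (u + v)"
      using linear_operatorD(2)[OF B, of u y' v z'] by (simp add: F.add)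
  next
    fix c u y
    assume "\<exists>v. B u = Some v \<and> y = v - F u"
    then obtain y' where "B u = Some y'" "y = y' - F u"
      by blast
    then show "\<exists>v. B (sX c u) = Some v \<and> sY c y = v - F (sX c u)"
      using linear_operatorD(3)[OF B, of u y' c] by (simp add: F.scale Y.scale_right_diff_distrib)
  qed
qed

lemma subspace_null_space:
  assumes "linear_operator sX sY A"
  shows "X.subspace (null_space A)"
  using linear_operatorD(1)[OF assms] linear_operatorD(2,3)[OF assms, where y = 0]
  by (auto simp: X.subspace_def null_space_def)

lemma subspace_ran:
  assumes A: "linear_operator sX sY A"
  shows "Y.subspace (ran A)"
  using linear_operatorD(1-3)[OF A] unfolding Y.subspace_def ran_def by blast

text \<open>Density makes the functional under \<open>THE\<close> unique, because two candidates
  agree on a closed set containing the domain. The value of the adjoint at \<open>g\<close> is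
  therefore zero exactly if \<open>g\<close> vanishes on the range.\<close>

lemma null_space_adjoint:
  assumes dense: "densely_defined A"
  shows "null_space (adjoint_op sX sY A) = Y.annihilator (ran A)"
proof -
  let ?P = "\<lambda>g f. f \<in> dual_space sX \<and>
    (\<forall>u\<in>dom A. blinfun_apply f u = blinfun_apply g (the (A u)))"
  have unique: "f = f'" if "?P g f" "?P g f'" for g f f'
  proof (rule blinfun_eqI)
    fix x
    have "x \<in> closure (dom A)"
      using dense by (simp add: densely_defined_def)
    moreover have "closed {x. blinfun_apply f x = blinfun_apply f' x}"
      by (intro closed_Collect_eq continuous_intros)
    moreover have "dom A \<subseteq> {x. blinfun_apply f x = blinfun_apply f' x}"
      using that by (intro subsetI CollectI) metis
    ultimately show "blinfun_apply f x = blinfun_apply f' x"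
      using closure_minimal by blast
  qed
  have zero: "?P g 0 \<longleftrightarrow> (\<forall>y\<in>ran A. blinfun_apply g y = 0)" for g
    by (auto simp: X.dual_space_iff ran_def dom_def)
  have "adjoint_op sX sY A g = Some 0 \<longleftrightarrow> g \<in> dual_space sY \<and> ?P g 0" for g
  proof
    assume *: "adjoint_op sX sY A g = Some 0"
    then have g: "g \<in> dual_space sY" and "\<exists>f. ?P g f" and the: "(THE f. ?P g f) = 0"
      by (auto simp: adjoint_op_def split: if_splits)
    then obtain f where f: "?P g f"
      by blast
    then have "(THE f. ?P g f) = f"
      using unique by (intro the_equality) auto
    then show "g \<in> dual_space sY \<and> ?P g 0"
      using the f g by simp
  next
    assume *: "g \<in> dual_space sY \<and> ?P g 0"
    then have "(THE f. ?P g f) = 0"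
      using unique by (intro the_equality) auto
    moreover have "adjoint_op sX sY A g = Some (THE f. ?P g f)"
      using * unfolding adjoint_op_def by (intro if_P) blast
    ultimately show "adjoint_op sX sY A g = Some 0"
      by simp
  qed
  then show ?thesis
    unfolding null_space_def Y.annihilator_def zero by simp
qed

section \<open>Decomposition of a Fredholm operator\<close>

lemma finite_rank_linear_combination:
  assumes "finite I" and h: "\<And>i. i \<in> I \<Longrightarrow> h i \<in> dual_space sX"
  shows "finite_rank sX sY (\<lambda>u. \<Sum>i\<in>I. sY (blinfun_apply (h i) u) (v i))"
    (is "finite_rank _ _ ?F")
proof -
  have "Vector_Spaces.linear sX sY ?F"
    using h by (auto simp: Vector_Spaces.linear_iff X.vector_space_axioms Y.vector_space_axioms
        blinfun.add_right Y.scale_left_distrib sum.distrib Y.scale_sum_right X.dual_space_iff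
        intro!: sum.cong)
  moreover have "bounded_linear ?F"
    by (intro bounded_linear_sum bounded_linear_compose[OF Y.bounded_linear_scale_left]
        blinfun.bounded_linear_right)
  moreover have "range ?F \<subseteq> Y.span (v ` I)"
    by (intro image_subsetI Y.span_sum Y.span_scale Y.span_base imageI)
  ultimately show ?thesis
    using assms(1) unfolding finite_rank_def bounded_operator_def finite_dim_def by blast
qed

theorem fredholm_operator_decomposition:
  assumes A: "fredholm_operator sX sY A"
  obtains B F where "A = op_diff B F" "linear_operator sX sY B" "closed_operator B" "dom B = dom A"
    "ran B = UNIV" "null_space B = {0}" "finite_rank sX sY F"
proof -
  have lin: "linear_operator sX sY A" and clo: "closed_operator A" and dense: "densely_defined A"
    and closed: "closed (ran A)" and nul: "equal_finite_nullity sX sY A"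
    using A unfolding fredholm_operator_def by (auto intro: closure_eq[THEN iffD1, OF sym])
  note ran = subspace_ran[OF lin] closed
  have fin: "finite_dim sX (null_space A)" "finite_dim dual_scale (Y.annihilator (ran A))"
    and dim: "X.dim (null_space A) = vector_space.dim dual_scale (Y.annihilator (ran A))"
    using nul unfolding equal_finite_nullity_def null_space_adjoint[OF dense] by auto
  obtain W where W: "finite W" "X.independent W" "W \<subseteq> null_space A" "null_space A \<subseteq> X.span W"
    by (rule X.finite_dim_basis[OF fin(1)])
  have "X.span W \<inter> {0} \<subseteq> {0}"
    by blast
  \<comment> \<open>Relative to the zero subspace, \<open>h\<close> extends the coordinate
    functionals of \<open>W\<close> to bounded functionals on the whole space.\<close>
  then obtain h where h: "X.biorthogonal {0} W h"
    using X.biorthogonal_exists[OF W(1,2) _ X.subspace_single_0] by auto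
  obtain V g where g: "Y.biorthogonal (ran A) V g" and V: "Y.span (ran A \<union> V) = UNIV"
    by (rule Y.finite_codim_if_annihilator[OF ran fin(2)])
  \<comment> \<open>Here the equality of the nullities enters: the adjoint's null space is the
    annihilator of the range, of dimension \<open>card V\<close>.\<close>
  have "card W = card V"
    using X.basis_card_eq_dim[OF W(3,4,2)] Y.dim_annihilator(2)[OF g ran(1) V] dim by simp
  moreover have "finite V"
    using g by (simp add: Y.biorthogonal_def)
  ultimately obtain \<pi> where \<pi>: "bij_betw \<pi> W V"
    using finite_same_card_bij[OF W(1)] by blast
  define F where "F u = (\<Sum>w\<in>W. sY (blinfun_apply (h w) u) (\<pi> w))" for u
  have h_dual: "h w \<in> dual_space sX" if "w \<in> W" for w
    using h that by (auto simp: X.biorthogonal_def X.annihilator_def)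
  have h_delta: "blinfun_apply (h w) w' = (if w = w' then 1 else 0)" if "w \<in> W" "w' \<in> W" for w w'
    using h that by (auto simp: X.biorthogonal_def)
  have \<pi>V: "\<pi> w \<in> V" if "w \<in> W" for w
    using \<pi> that by (rule bij_betwE[THEN bspec])
  have g_dual: "g v \<in> dual_space sY" "\<And>y. y \<in> ran A \<Longrightarrow> blinfun_apply (g v) y = 0" if "v \<in> V" for v
    using g that by (auto simp: Y.biorthogonal_def Y.annihilator_def)
  have F: "finite_rank sX sY F"
    unfolding F_def by (rule finite_rank_linear_combination[OF W(1) h_dual])
  then have F_lin: "Vector_Spaces.linear sX sY F" and F_bl: "bounded_linear F"
    by (auto simp: finite_rank_def bounded_operator_def)
  interpret F: Vector_Spaces.linear sX sY F by (rule F_lin)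
  \<comment> \<open>\<open>g (\<pi> w)\<close> recovers one coordinate of \<open>u\<close> from
    \<open>F u\<close>, because \<open>g\<close> is dual to \<open>V\<close> and
    \<open>\<pi>\<close> is injective on \<open>W\<close>.\<close>
  have gF: "blinfun_apply (g (\<pi> w)) (F u) = blinfun_apply (h w) u" if "w \<in> W" for w u
  proof -
    have "blinfun_apply (g (\<pi> w)) (F u) =
        (\<Sum>w'\<in>W. blinfun_apply (h w') u * blinfun_apply (g (\<pi> w)) (\<pi> w'))"
      using g_dual(1)[OF \<pi>V[OF that]] by (simp add: F_def blinfun.sum_right Y.dual_space_iff)
    also have "\<dots> = (\<Sum>w'\<in>W. if w' = w then blinfun_apply (h w') u else 0)"
    proof (rule sum.cong)
      fix w' assume w': "w' \<in> W"
      have "blinfun_apply (g (\<pi> w)) (\<pi> w') = (if \<pi> w = \<pi> w' then 1 else 0)"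
        using g \<pi>V[OF that] \<pi>V[OF w'] unfolding Y.biorthogonal_def by blast
      also have "\<pi> w = \<pi> w' \<longleftrightarrow> w = w'"
        using \<pi> that w' unfolding bij_betw_def by (metis inj_onD)
      finally show "blinfun_apply (h w') u * blinfun_apply (g (\<pi> w)) (\<pi> w') =
          (if w' = w then blinfun_apply (h w') u else 0)"
        by simp
    qed simp
    also have "\<dots> = blinfun_apply (h w) u"
      using that W(1) by simp
    finally show ?thesis .
  qed
  define B where "B = op_diff A (\<lambda>u. - F u)"
  have B_iff: "B u = Some y \<longleftrightarrow> (\<exists>v. A u = Some v \<and> y = v + F u)" for u y
    by (auto simp: B_def op_diff_eq_Some_iff)
  have "A u = op_diff B F u" for u
    by (cases "A u") (auto simp: B_def op_diff_def)
  then have "A = op_diff B F"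
    by blast
  moreover have "linear_operator sX sY B"
    unfolding B_def
    by (rule linear_operator_op_diff[OF lin]) (simp add: Vector_Spaces.linear_iff
        X.vector_space_axioms Y.vector_space_axioms F.add F.scale)
  moreover have "closed_operator B"
    unfolding B_def
    by (intro closed_operator_op_diff clo continuous_intros bounded_linear.continuous_on[OF F_bl])
  moreover have "dom B = dom A"
    by (simp add: B_def)
  moreover have "ran B = UNIV"
  proof (rule UNIV_eq_I[symmetric])
    fix y
    let ?m = "y - (\<Sum>v\<in>V. sY (blinfun_apply (g v) y) v)"
    have "?m \<in> ran A"
      by (rule Y.biorthogonal_expansion[OF g ran(1)]) (simp add: V)
    then obtain u where u: "A u = Some ?m"
      by (auto simp: ran_def)
    \<comment> \<open>The preimage \<open>u\<close> of \<open>?m\<close> may be changed by null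
      vectors. Adding \<open>z\<close> makes the \<open>W\<close>-coordinates of \<open>u\<close>
      agree with the \<open>V\<close>-coordinates of \<open>y\<close>, so that
      \<open>F (u + z)\<close> supplies the part of \<open>y\<close> missing from
      \<open>?m\<close>.\<close>
    define z where
      "z = (\<Sum>w\<in>W. sX (blinfun_apply (g (\<pi> w)) y - blinfun_apply (h w) u) w)"
    have "z \<in> null_space A"
      unfolding z_def
      by (intro X.subspace_sum X.subspace_scale subspace_null_space[OF lin]) (use W(3) in blast)
    then have "A (u + z) = Some ?m"
      using linear_operatorD(2)[OF lin u, of z 0] by (simp add: null_space_def)
    moreover have "blinfun_apply (h w) (u + z) = blinfun_apply (g (\<pi> w)) y" if "w \<in> W" for w
    proof -
      have "blinfun_apply (h w) z = (\<Sum>w'\<in>W.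
          (blinfun_apply (g (\<pi> w')) y - blinfun_apply (h w') u) * blinfun_apply (h w) w')"
        using h_dual[OF that] by (simp add: z_def blinfun.sum_right X.dual_space_iff)
      also have "\<dots> = (\<Sum>w'\<in>W. if w' = w
          then blinfun_apply (g (\<pi> w')) y - blinfun_apply (h w') u else 0)"
        by (rule sum.cong) (auto simp: h_delta[OF that])
      also have "\<dots> = blinfun_apply (g (\<pi> w)) y - blinfun_apply (h w) u"
        using that W(1) by simp
      finally show ?thesis
        by (simp add: blinfun.add_right)
    qed
    then have "F (u + z) = (\<Sum>w\<in>W. sY (blinfun_apply (g (\<pi> w)) y) (\<pi> w))"
      by (simp add: F_def)
    moreover have "\<dots> = (\<Sum>v\<in>V. sY (blinfun_apply (g v) y) v)"
      by (rule sum.reindex_bij_betw[OF \<pi>])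
    ultimately have "B (u + z) = Some y"
      by (simp add: B_iff)
    then show "y \<in> ran B"
      by (rule ranI)
  qed
  moreover have "null_space B = {0}"
  proof
    show "null_space B \<subseteq> {0}"
    proof
      fix u assume "u \<in> null_space B"
      then obtain a where a: "A u = Some a" "a = - F u"
        by (auto simp: null_space_def B_iff eq_neg_iff_add_eq_0)
      \<comment> \<open>\<open>- F u\<close> is in the range of \<open>A\<close>, where
        \<open>g (\<pi> w)\<close> vanishes, so all coordinates of \<open>u\<close> are zero. Then
        \<open>F u = 0\<close>, so \<open>u\<close> is a null vector of \<open>A\<close> without
        coordinates, that is, zero.\<close>
      have h0: "blinfun_apply (h w) u = 0" if "w \<in> W" for w
        using g_dual(2)[OF \<pi>V[OF that] ranI[of A, OF a(1)]] gF[OF that, of u]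
        by (simp add: a(2) blinfun.minus_right)
      then have "F u = 0"
        by (simp add: F_def)
      then have "u \<in> X.span W"
        using a W(4) by (auto simp: null_space_def)
      then have "u - (\<Sum>w\<in>W. sX (blinfun_apply (h w) u) w) \<in> {0}"
        using X.span_mono[of W "{0} \<union> W"]
        by (intro X.biorthogonal_expansion[OF h X.subspace_single_0]) blast
      then show "u \<in> {0}"
        using h0 by simp
    qed
    show "{0} \<subseteq> null_space B"
      using linear_operatorD(1)[OF lin] by (simp add: null_space_def B_iff)
  qed
  ultimately show ?thesis
    using F by - (rule that[of B F])
qed

section \<open>Finite-rank perturbations of a bijective operator\<close>

text \<open>The inverse is defined everywhere because \<open>B\<close> is surjective, and its graph
  is the closed graph of \<open>B\<close> with the components exchanged.\<close>

lemma bounded_inverse_operator: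
  assumes lin: "linear_operator sX sY B" and clo: "closed_operator B"
    and ran: "ran B = UNIV" and nul: "null_space B = {0}"
  obtains T where "bounded_operator sY sX T" "\<And>u y. B u = Some y \<longleftrightarrow> u = T y"
proof -
  have ex: "\<exists>u. B u = Some y" for y
    using ran unfolding ran_def by blast
  have inj: "u = v" if "B u = Some y" "B v = Some y" for u v y
  proof -
    have "u - v \<in> null_space B"
      using linear_operatorD(4)[OF lin that] by (simp add: null_space_def)
    then show ?thesis
      using nul by simp
  qed
  define T where "T y = (THE u. B u = Some y)" for y
  have T_iff: "B u = Some y \<longleftrightarrow> u = T y" for u y
    using theI'[of "\<lambda>u. B u = Some y"] ex inj unfolding T_def by blast
  have BT: "B (T y) = Some y" for y
    by (simp add: T_iff)
  have add: "T (y + z) = T y + T z" and scale: "T (sY c y) = sX c (T y)" for y z c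
    using linear_operatorD(2)[OF lin BT BT] linear_operatorD(3)[OF lin BT] by (simp_all add: T_iff)
  have "linear T"
    by (rule linearI) (simp_all add: add X.scaleR_eq Y.scaleR_eq scale)
  then have "bounded_linear T"
  proof (rule closed_graph_theorem)
    fix f y x assume "f \<longlonglongrightarrow> y" "(\<lambda>n. T (f n)) \<longlonglongrightarrow> x"
    then have "(\<lambda>n. (T (f n), f n)) \<longlonglongrightarrow> (x, y)"
      by (intro tendsto_Pair)
    moreover have "(T (f n), f n) \<in> Map.graph B" for n
      by (simp add: Map.graph_def BT)
    ultimately have "(x, y) \<in> Map.graph B"
      using clo unfolding closed_operator_def by (meson closed_sequentially)
    then show "T y = x"
      by (simp add: Map.graph_def T_iff)
  qed
  then have "bounded_operator sY sX T"
    by (simp add: bounded_operator_def Vector_Spaces.linear_iff add scale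
        X.vector_space_axioms Y.vector_space_axioms)
  then show ?thesis
    by (rule that[OF _ T_iff])
qed

theorem fredholm_operator_finite_rank_perturbation:
  assumes lin: "linear_operator sX sY B" and clo: "closed_operator B" and dense: "densely_defined B"
    and ran: "ran B = UNIV" and nul: "null_space B = {0}" and F: "finite_rank sX sY F"
  shows "fredholm_operator sX sY (op_diff B F)"
proof -
  let ?A = "op_diff B F"
  have F_lin: "Vector_Spaces.linear sX sY F" and F_bl: "bounded_linear F"
    and F_fin: "finite_dim sY (range F)"
    using F by (auto simp: finite_rank_def bounded_operator_def)
  obtain T where T: "bounded_operator sY sX T" and T_iff: "\<And>u y. B u = Some y \<longleftrightarrow> u = T y"
    using bounded_inverse_operator[OF lin clo ran nul] by blast
  have T_lin: "Vector_Spaces.linear sY sX T" and T_bl: "bounded_linear T"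
    using T by (auto simp: bounded_operator_def)
  interpret F: Vector_Spaces.linear sX sY F by (rule F_lin)
  interpret T: Vector_Spaces.linear sY sX T by (rule T_lin)
  define K where "K y = F (T y)" for y
  define L where "L y = y - K y" for y
  have K_lin: "Vector_Spaces.linear sY sY K"
    by (simp add: Vector_Spaces.linear_iff Y.vector_space_axioms K_def F.add F.scale T.add T.scale)
  interpret K: Vector_Spaces.linear sY sY K by (rule K_lin)
  have K_bl: "bounded_linear K"
    unfolding K_def by (rule bounded_linear_compose[OF F_bl T_bl])
  have K_fin: "finite_dim sY (range K)"
    using F_fin unfolding finite_dim_def K_def by blast
  have R: "Y.subspace (range K)"
    by (rule K.subspace_image) simp
  have L_lin: "Vector_Spaces.linear sY sY L"
    by (simp add: Vector_Spaces.linear_iff Y.vector_space_axioms L_def K.add K.scale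
        Y.scale_right_diff_distrib)
  interpret L: Vector_Spaces.linear sY sY L by (rule L_lin)
  \<comment> \<open>\<open>L y\<close> and \<open>y\<close> differ by \<open>K y\<close>; so kernel
    and cokernel of \<open>L\<close> can be compared inside \<open>range K\<close>.\<close>
  have "L y \<in> range K \<longleftrightarrow> y \<in> range K" for y
    using Y.subspace_add[OF R, of "L y" "K y"] Y.subspace_diff[OF R, of y "K y"]
    by (auto simp: L_def)
  then obtain W V where W: "finite W" "Y.independent W" "Y.span W = {y. L y = 0}"
    and V: "finite V" "Y.independent V" "V \<subseteq> range K" "Y.span V \<inter> range L \<subseteq> {0}"
      "range K \<subseteq> Y.span (range L \<union> V)"
    and card: "card V = card W"
    by (rule Y.kernel_cokernel_bases[OF L_lin R K_fin])
  \<comment> \<open>With \<open>y\<close> the value of \<open>B\<close> at \<open>u\<close>, so that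
    \<open>u = T y\<close>, the difference becomes \<open>y - F (T y) = L y\<close>.\<close>
  have A_iff: "?A u = Some w \<longleftrightarrow> (\<exists>y. u = T y \<and> w = L y)" for u w
    by (auto simp: op_diff_eq_Some_iff T_iff L_def K_def)
  then have ran_A: "ran ?A = range L"
    by (auto simp: ran_def)
  have null_A: "null_space ?A = T ` Y.span W"
    unfolding W(3) by (auto simp: null_space_def A_iff)
  have ran_sub: "Y.subspace (range L)"
    by (rule L.subspace_image) simp
  have ran_closed: "closed (range L)"
  proof -
    obtain E where E: "finite E" "Y.span ({y. K y = 0} \<union> E) = UNIV"
      by (rule Y.finite_codim_kernel[OF K_lin K_fin])
    have "range L = Y.span (L ` ({y. K y = 0} \<union> E))"
      by (simp only: L.span_image E(2))
    \<comment> \<open>\<open>L\<close> is the identity on the kernel of \<open>K\<close>, so its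
      range arises from a closed subspace by adding finitely many vectors.\<close>
    also have "L ` ({y. K y = 0} \<union> E) = {y. K y = 0} \<union> L ` E"
      by (auto simp: L_def image_Un intro: image_eqI)
    also have "closed (Y.span \<dots>)"
      using E(1) K.subspace_kernel
      by (intro Y.closed_span_Un_finite closed_Collect_eq continuous_intros
          bounded_linear.continuous_on[OF K_bl]) auto
    finally show ?thesis .
  qed
  obtain g where g: "Y.biorthogonal (range L) V g"
    using Y.biorthogonal_exists[OF V(1,2,4) ran_sub ran_closed] by blast
  \<comment> \<open>This follows from \<open>y = L y + K y\<close>, as \<open>range K\<close> is
    already covered.\<close>
  have "y \<in> Y.span (range L \<union> V)" for y
  proof -
    have "L y \<in> Y.span (range L \<union> V)" "K y \<in> Y.span (range L \<union> V)"
      using V(5) by (auto intro: Y.span_base)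
    from Y.span_add[OF this] show ?thesis
      by (simp add: L_def)
  qed
  then have "Y.span (range L \<union> V) = UNIV"
    by blast
  note ann = Y.dim_annihilator[OF g ran_sub this]
  \<comment> \<open>Injectivity of \<open>T\<close> carries the basis \<open>W\<close> of the kernel
    of \<open>L\<close> to a basis of the null space with the same cardinality.\<close>
  have "inj T"
    using T_iff by (metis injI option.inject)
  then have T_ind: "X.independent (T ` W)"
    by (rule T.independent_inj_image[OF W(2)])
  have null_span: "null_space ?A = X.span (T ` W)"
    by (simp add: null_A T.span_image)
  have dense_A: "densely_defined ?A"
    using dense by (simp add: densely_defined_def)
  have "equal_finite_nullity sX sY ?A"
    unfolding equal_finite_nullity_def null_space_adjoint[OF dense_A] ran_A
  proof (intro conjI ann(1))
    show "finite_dim sX (null_space ?A)"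
      using W(1) unfolding finite_dim_def null_span by blast
    show "X.dim (null_space ?A) = vector_space.dim dual_scale (Y.annihilator (range L))"
      unfolding null_span X.dim_span_eq_card_independent[OF T_ind] ann(2) card
      by (rule card_image) (use \<open>inj T\<close> in \<open>auto intro: inj_on_subset\<close>)
  qed
  moreover have "linear_operator sX sY ?A" "closed_operator ?A"
    by (intro linear_operator_op_diff closed_operator_op_diff lin F_lin clo
        bounded_linear.continuous_on[OF F_bl] continuous_intros)+
  ultimately show ?thesis
    using dense_A ran_closed ran_A by (simp add: fredholm_operator_def closure_closed)
qed

end

theorem theorem1p1:
  fixes sX :: "'k::{real_normed_field, euclidean_space} \<Rightarrow> 'x::banach \<Rightarrow> 'x"
    and sY :: "'k \<Rightarrow> 'y::banach \<Rightarrow> 'y"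
  assumes "banach_space_over sX" and "banach_space_over sY"
  shows
    "(\<forall>A. fredholm_operator sX sY A \<longrightarrow>
        (\<exists>B F. A = op_diff B F \<and>
           linear_operator sX sY B \<and> closed_operator B \<and> dom B = dom A \<and>
           ran B = UNIV \<and> null_space B = {0} \<and>
           finite_rank sX sY F)) \<and>
     (\<forall>A B F. A = op_diff B F \<and>
        linear_operator sX sY B \<and> closed_operator B \<and> densely_defined B \<and>
        ran B = UNIV \<and> null_space B = {0} \<and>
        finite_rank sX sY F \<longrightarrow>
          closed_operator A \<and> dom A = dom B \<and> ran A = closure (ran A) \<and>
          equal_finite_nullity sX sY A \<and> fredholm_operator sX sY A)"
proof -
  interpret banach_space_pair sX sY
    using assms by (simp add: banach_space_pair_def)
  show ?thesis
  proof (intro conjI[of "All _"] allI impI)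
    fix A assume "fredholm_operator sX sY A"
    then show "\<exists>B F. A = op_diff B F \<and> linear_operator sX sY B \<and> closed_operator B \<and>
        dom B = dom A \<and> ran B = UNIV \<and> null_space B = {0} \<and> finite_rank sX sY F"
      by (rule fredholm_operator_decomposition) blast
  next
    fix A B F
    assume *: "A = op_diff B F \<and> linear_operator sX sY B \<and> closed_operator B \<and>
      densely_defined B \<and> ran B = UNIV \<and> null_space B = {0} \<and> finite_rank sX sY F"
    then have "fredholm_operator sX sY A"
      using fredholm_operator_finite_rank_perturbation by blast
    then show "closed_operator A \<and> dom A = dom B \<and> ran A = closure (ran A) \<and>
        equal_finite_nullity sX sY A \<and> fredholm_operator sX sY A"
      using * by (simp add: fredholm_operator_def)
  qed
qed

end
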